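(* Let $d\ge1$, $1\le p<\infty$, and let $\nu:\mathbb{R}^d\setminus\{0\}\to[0,\infty)$ be measurable. Let $w:[0,\infty)\to[0,\infty)$, $w(r)=(r\,\nu^\#(r))^{1/p}$, be the potential associated with $\nu$ (see context). Assume that $r\mapsto w(r)$ is invertible, that $t\mapsto\phi_p(t)=\phi(t^{1/p})$ is a Young function, where $\phi(t)=1/w^{-1}(1/t)$, and that there is $\theta>0$ such that $\phi\big(\theta\frac st\big)\le\frac{\phi(s)}{\phi(t)}$ for all $0\le s\le t$. If $\nu$ is almost decreasing (that is, $\nu$ is radial, written $\nu(h)=\nu(|h|)$, and there is $0<\kappa\le1$ with $\kappa\,\nu(|x|)\le\nu(|y|)$ for all $|x|\ge|y|$) and $\Omega\subset\mathbb{R}^d$ is a $W^p_\nu$-extension domain, then the Poincaré–Sobolev inequality holds, that is, there is a constant $C=C(\Omega,\nu,p,d)>0$, depending only on $\Omega,\nu,d$ and $p$, such that $$\Big\|u-\frac1{|\Omega|}\int_\Omega u\Big\|_{L^\phi(\Omega)}\le C\Big(\int_\Omega\int_\Omega|u(x)-u(y)|^p\nu(x-y)\,dy\,dx\Big)^{1/p}\quad\text{for all }u\in L^\phi(\Omega).$$ In particular, if $s\in(0,1)$, $p^*_s>0$ where $\frac1{p^*_s}=\frac1p-\frac sd$, and $\Omega$ is a $W^{s,p}$-extension domain, then there is a constant $C>0$ such that $$\Big\|u-\frac1{|\Omega|}\int_\Omega u\Big\|_{L^{p^*_s}(\Omega)}\le C\Big(\int_\Omega\int_\Omega\frac{|u(x)-u(y)|^p}{|x-y|^{d+sp}}\,dy\,dx\Big)^{1/p}\quad\text{for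 all }u\in L^{p^*_s}(\Omega).$$
   Context: $|E|$ is Lebesgue measure, $c_d=|B(0,1)|$, $\eta(r)=(r/c_d)^{1/d}$. The symmetric decreasing rearrangement of $\nu$ is the radial function $\nu^*(\rho)=\inf\{s>0:|\{\nu>s\}|\le c_d\rho^d\}$, $\rho\ge0$. Define $\nu^\#(r)=\int_{\{\nu<\nu^*(\eta(r))\}}\nu(h)\,dh$, $w(r)=(r\,\nu^\#(r))^{1/p}$ for $r>0$, $w(0)=0$, and $\phi(t)=1/w^{-1}(1/t)$ for $t>0$, $\phi(0)=0$. A Young function is a convex function $\phi:[0,\infty]\to[0,\infty]$ with $\phi(0)=0$, not identically $0$ and not identically $\infty$ on $(0,\infty)$. $L^\phi(\Omega)$ is the Orlicz space of measurable $u:\Omega\to\mathbb{R}$ with $\int_\Omega\phi(|u|/\lambda)\,dx<\infty$ for some $\lambda>0$, with Luxemburg norm $\|u\|_{L^\phi(\Omega)}=\inf\{\lambda>0:\int_\Omega\phi(|u|/\lambda)\,dx\le1\}$. For $\Omega$ open, $W^p_\nu(\Omega)=\{u\in L^p(\Omega):\int_\Omega\int_\Omega|u(x)-u(y)|^p\nu(x-y)\,dy\,dx<\infty\}$ with norm $\|u\|_{W^p_\nu(\Omega)}=\big(\|u\|^p_{L^p(\Omega)}+\int_\Omega\int_\Omega|u(x)-u(y)|^p\nu(x-y)\,dy\,dx\big)^{1/p}$. An open set $\Omega\subset\mathbb{R}^d$ is a $W^p_\nu$-extension domain if there are a linear operator $E:W^p_\nu(\Omega)\to W^p_\nu(\mathbb{R}^d)$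 and a constant $C=C(\Omega,\nu,d,p)$ such that $Eu|_\Omega=u$ and $\|Eu\|_{W^p_\nu(\mathbb{R}^d)}\le C\|u\|_{W^p_\nu(\Omega)}$ for all $u\in W^p_\nu(\Omega)$; a $W^{s,p}$-extension domain is the case $\nu(h)=|h|^{-d-sp}$.
   Formalization: Ω is assumed to have finite measure, so that the mean over Ω is defined; in the general (not the fractional) part it is also assumed that Ω is bounded or ν is not integrable over R^d, since for integrable ν and unbounded Ω of finite measure the inequality fails. *)

theory Defs
  imports "HOL-Analysis.Analysis"
begin

text \<open>
  The space \<open>\<real>\<^sup>d\<close> is an arbitrary Euclidean space \<open>'a\<close> with \<open>d = DIM('a)\<close> (so \<open>d \<ge> 1\<close>).
  A function on \<open>\<Omega>\<close> is a total function of which only the values on \<open>\<Omega>\<close> matter; all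
  identities between elements of function spaces are almost everywhere identities.
  Norms and integrals that may be infinite take values in \<^typ>\<open>ennreal\<close>.
\<close>

text \<open>Real powers on \<open>[0,\<infinity>]\<close>; only used for exponents \<open>a > 0\<close>.\<close>

definition ennreal_powr :: "ennreal \<Rightarrow> real \<Rightarrow> ennreal" where
  "ennreal_powr t a = (if t = \<infinity> then \<infinity> else ennreal (enn2real t powr a))"

section \<open>The potential and the Orlicz function of a kernel\<close>

definition unit_ball_measure :: "'a::euclidean_space itself \<Rightarrow> real" where
  "unit_ball_measure _ = measure lebesgue (ball (0::'a) 1)"

definition eta :: "'a::euclidean_space itself \<Rightarrow> real \<Rightarrow> real" where
  "eta T r = (r / unit_ball_measure T) powr (1 / real DIM('a))"

text \<open>
  A kernel is defined on \<open>\<real>\<^sup>d - {0}\<close>; its value at \<open>0\<close> is never used. The infimum is taken in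
  \<open>[0,\<infinity>]\<close>, hence it is \<open>\<infinity>\<close> if no level \<open>s\<close> qualifies (e.g. \<open>\<rho> = 0\<close> and \<open>\<nu>\<close> unbounded).
\<close>

definition sym_rearrangement :: "('a::euclidean_space \<Rightarrow> real) \<Rightarrow> real \<Rightarrow> ennreal" where
  "sym_rearrangement \<nu> \<rho> =
     Inf {ennreal s | s. 0 < s \<and>
       emeasure lebesgue {h. h \<noteq> 0 \<and> s < \<nu> h} \<le> ennreal (unit_ball_measure TYPE('a) * \<rho> ^ DIM('a))}"

definition nu_sharp :: "('a::euclidean_space \<Rightarrow> real) \<Rightarrow> real \<Rightarrow> ennreal" where
  "nu_sharp \<nu> r =
     (\<integral>\<^sup>+h\<in>{h. h \<noteq> 0 \<and> ennreal (\<nu> h) < sym_rearrangement \<nu> (eta TYPE('a) r)}. ennreal (\<nu> h) \<partial>lebesgue)"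

definition potential :: "('a::euclidean_space \<Rightarrow> real) \<Rightarrow> real \<Rightarrow> real \<Rightarrow> real" where
  "potential \<nu> p r = (if r = 0 then 0 else (r * enn2real (nu_sharp \<nu> r)) powr (1 / p))"

text \<open>
  \<open>\<phi> t = 1 / w\<^sup>-\<^sup>1 (1 / t)\<close>. As \<open>w\<^sup>-\<^sup>1 0 = 0\<close> and \<open>1 / 0 = \<infinity>\<close> in \<^typ>\<open>ennreal\<close>, the formula also yields
  \<open>\<phi> \<infinity> = \<infinity>\<close>.
\<close>

definition orlicz_phi :: "('a::euclidean_space \<Rightarrow> real) \<Rightarrow> real \<Rightarrow> ennreal \<Rightarrow> ennreal" where
  "orlicz_phi \<nu> p t =
     (if t = 0 then 0
      else 1 / ennreal (inv_into {0..} (potential \<nu> p) (enn2real (1 / t))))"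

definition orlicz_phi_p :: "('a::euclidean_space \<Rightarrow> real) \<Rightarrow> real \<Rightarrow> ennreal \<Rightarrow> ennreal" where
  "orlicz_phi_p \<nu> p t = orlicz_phi \<nu> p (ennreal_powr t (1 / p))"

definition almost_decreasing :: "('a::euclidean_space \<Rightarrow> real) \<Rightarrow> bool" where
  "almost_decreasing \<nu> \<longleftrightarrow>
     (\<forall>x y. x \<noteq> 0 \<and> y \<noteq> 0 \<and> norm x = norm y \<longrightarrow> \<nu> x = \<nu> y) \<and>
     (\<exists>\<kappa>. 0 < \<kappa> \<and> \<kappa> \<le> 1 \<and>
        (\<forall>x y. x \<noteq> 0 \<and> y \<noteq> 0 \<and> norm x \<ge> norm y \<longrightarrow> \<kappa> * \<nu> x \<le> \<nu> y))"

section \<open>Orlicz and Lebesgue spaces\<close>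

definition young_function :: "(ennreal \<Rightarrow> ennreal) \<Rightarrow> bool" where
  "young_function \<phi> \<longleftrightarrow>
     (\<forall>x y. \<forall>l\<in>{0..1}. \<phi> (ennreal l * x + ennreal (1 - l) * y)
                        \<le> ennreal l * \<phi> x + ennreal (1 - l) * \<phi> y) \<and>
     \<phi> 0 = 0 \<and>
     (\<exists>t. 0 < t \<and> t < \<infinity> \<and> \<phi> t \<noteq> 0) \<and>
     (\<exists>t. 0 < t \<and> t < \<infinity> \<and> \<phi> t \<noteq> \<infinity>)"

definition orlicz_space ::
  "(ennreal \<Rightarrow> ennreal) \<Rightarrow> 'a::euclidean_space set \<Rightarrow> ('a \<Rightarrow> real) set" where
  "orlicz_space \<phi> \<Omega> =
     {u \<in> borel_measurable (lebesgue_on \<Omega>).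
        \<exists>l>0. (\<integral>\<^sup>+x. \<phi> (ennreal (\<bar>u x\<bar> / l)) \<partial>lebesgue_on \<Omega>) < \<infinity>}"

definition luxemburg_norm ::
  "(ennreal \<Rightarrow> ennreal) \<Rightarrow> 'a::euclidean_space set \<Rightarrow> ('a \<Rightarrow> real) \<Rightarrow> ennreal" where
  "luxemburg_norm \<phi> \<Omega> u =
     Inf {ennreal l | l. 0 < l \<and> (\<integral>\<^sup>+x. \<phi> (ennreal (\<bar>u x\<bar> / l)) \<partial>lebesgue_on \<Omega>) \<le> 1}"

definition Lp_integral :: "real \<Rightarrow> 'a::euclidean_space set \<Rightarrow> ('a \<Rightarrow> real) \<Rightarrow> ennreal" where
  "Lp_integral q \<Omega> u = (\<integral>\<^sup>+x. ennreal (\<bar>u x\<bar> powr q) \<partial>lebesgue_on \<Omega>)"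

definition Lp_norm :: "real \<Rightarrow> 'a::euclidean_space set \<Rightarrow> ('a \<Rightarrow> real) \<Rightarrow> ennreal" where
  "Lp_norm q \<Omega> u = ennreal_powr (Lp_integral q \<Omega> u) (1 / q)"

definition Lp_space :: "real \<Rightarrow> 'a::euclidean_space set \<Rightarrow> ('a \<Rightarrow> real) set" where
  "Lp_space q \<Omega> = {u \<in> borel_measurable (lebesgue_on \<Omega>). Lp_integral q \<Omega> u < \<infinity>}"

definition mean :: "'a::euclidean_space set \<Rightarrow> ('a \<Rightarrow> real) \<Rightarrow> real" where
  "mean \<Omega> u = 1 / measure lebesgue \<Omega> * (\<integral>x. u x \<partial>lebesgue_on \<Omega>)"

section \<open>Nonlocal Sobolev spaces and extension domains\<close>

definition nonlocal_energy ::
  "real \<Rightarrow> ('a::euclidean_space \<Rightarrow> real) \<Rightarrow> 'a set \<Rightarrow> ('a \<Rightarrow> real) \<Rightarrow> ennreal" where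
  "nonlocal_energy p \<nu> \<Omega> u =
     (\<integral>\<^sup>+x. (\<integral>\<^sup>+y. ennreal (\<bar>u x - u y\<bar> powr p * \<nu> (x - y)) \<partial>lebesgue_on \<Omega>) \<partial>lebesgue_on \<Omega>)"

definition nonlocal_space ::
  "real \<Rightarrow> ('a::euclidean_space \<Rightarrow> real) \<Rightarrow> 'a set \<Rightarrow> ('a \<Rightarrow> real) set" where
  "nonlocal_space p \<nu> \<Omega> = {u \<in> Lp_space p \<Omega>. nonlocal_energy p \<nu> \<Omega> u < \<infinity>}"

definition nonlocal_norm ::
  "real \<Rightarrow> ('a::euclidean_space \<Rightarrow> real) \<Rightarrow> 'a set \<Rightarrow> ('a \<Rightarrow> real) \<Rightarrow> ennreal" where
  "nonlocal_norm p \<nu> \<Omega> u = ennreal_powr (Lp_integral p \<Omega> u + nonlocal_energy p \<nu> \<Omega> u) (1 / p)"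

text \<open>
  The operator acts on representatives and is linear up to null sets. With the norm bound this
  makes it well defined and linear on almost everywhere equivalence classes.
\<close>

definition nonlocal_extension_domain ::
  "real \<Rightarrow> ('a::euclidean_space \<Rightarrow> real) \<Rightarrow> 'a set \<Rightarrow> bool" where
  "nonlocal_extension_domain p \<nu> \<Omega> \<longleftrightarrow> open \<Omega> \<and>
     (\<exists>(E :: ('a \<Rightarrow> real) \<Rightarrow> 'a \<Rightarrow> real) (C :: real).
        (\<forall>u\<in>nonlocal_space p \<nu> \<Omega>. \<forall>v\<in>nonlocal_space p \<nu> \<Omega>. \<forall>a b.
           AE x in lebesgue. E (\<lambda>y. a * u y + b * v y) x = a * E u x + b * E v x) \<and>
        (\<forall>u\<in>nonlocal_space p \<nu> \<Omega>.
           E u \<in> nonlocal_space p \<nu> UNIV \<and>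
           (AE x in lebesgue_on \<Omega>. E u x = u x) \<and>
           nonlocal_norm p \<nu> UNIV (E u) \<le> ennreal C * nonlocal_norm p \<nu> \<Omega> u))"

definition fractional_kernel :: "real \<Rightarrow> real \<Rightarrow> 'a::euclidean_space \<Rightarrow> real" where
  "fractional_kernel s p h = norm h powr (- real DIM('a) - s * p)"

end

theory Submission
  imports Defs
begin

text \<open>
  Let \<open>I(l)\<close> be the integral of \<open>\<phi> (\<bar>v\<bar> / l)\<close> over the whole space. If \<open>I(l) \<le> 1\<close>, Chebyshev's
  inequality bounds the measure of \<open>F = {\<bar>v\<bar> > \<bar>v x\<bar> / 2}\<close> by \<open>1 / \<phi> (\<bar>v x\<bar> / (2 l))\<close>. The part
  of the inner energy integral at \<open>x\<close> that comes from the complement of \<open>F\<close> is therefore at least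
  \<open>l\<^sup>p \<phi> (\<bar>v x\<bar> / (2 l))\<close>: by rearrangement \<open>\<nu>\<close> has mass at least \<open>\<nu>\<^sup># (\<bar>F\<bar>)\<close> off any translate of
  \<open>F\<close>, and \<open>\<phi>\<close> is tuned to \<open>\<nu>\<^sup>#\<close>. Integrating in \<open>x\<close> and using the doubling property of \<open>\<phi>\<close> (from
  its submultiplicativity), \<open>I(l) \<le> 1\<close> implies \<open>I(l/2) \<le> 1\<close> as long as the energy is at most a fixed
  multiple of \<open>l\<^sup>p\<close>. Descending from a large \<open>l\<close> gives the Sobolev inequality on the whole space. The
  extension operator transfers it to \<open>\<Omega>\<close>, with an additional \<open>L\<^sup>p\<close> norm that a Poincare inequality
  removes.
\<close>

text \<open>Tuning means \<open>nu_sharp\<close> at \<open>r = 1 / phi t\<close> equals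
  \<open>phi t / t powr p\<close>. The descent needs a scale at which to begin, and for a general
  \<open>u\<close> in \<open>L^p\<close> no scale is known to have a finite modular. Truncations of
  \<bar>u\<bar> supply one: they are bounded, live on a set of finite measure and do not raise the
  energy, and convexity pushes their modular below 1 at a large scale. Fatou's lemma then returns to
  \<open>u\<close>.

  The Poincare inequality is where bounded and unbounded \<Omega> part ways. On a bounded set the
  kernel is bounded below along all differences of points, and Jensen's inequality is enough. On an
  unbounded \<Omega> of finite measure the \<open>L^p\<close> mass far out has to be absorbed, which
  requires \<open>phi t / t powr p\<close> to tend to infinity, that is, \<open>nu_sharp\<close> to
  be unbounded near 0. This follows when \<nu> is neither integrable nor essentially bounded.
  Non-integrability is assumed in that case; essential unboundedness is extracted from the extension
  property, applied to the constant function 1.\<close>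

lemma lebesgue_measurable_reflect:
  "(\<lambda>y. x - y) \<in> lebesgue \<rightarrow>\<^sub>M (lebesgue :: 'a::euclidean_space measure)"
  and nn_integral_lebesgue_reflect:
  "f \<in> borel_measurable lebesgue \<Longrightarrow>
     (\<integral>\<^sup>+y. f (x - y) \<partial>lebesgue) = (\<integral>\<^sup>+h. f h \<partial>(lebesgue :: 'a measure))"
proof -
  \<comment> \<open>Reflection is a translation plus coordinatewise scaling by -1, the form covered
    by the affine change of variables. Its density is a product of factors \<bar>-1\<bar>, hence
    1.\<close>
  have eq: "(\<lambda>y. x - y) = (\<lambda>y. x + (\<Sum>j\<in>Basis. ((-1) * (y \<bullet> j)) *\<^sub>R j))"
    using euclidean_representation[of "- y" for y]
    by (auto simp: fun_eq_iff sum_negf euclidean_representation)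
  show meas: "(\<lambda>y. x - y) \<in> lebesgue \<rightarrow>\<^sub>M (lebesgue :: 'a measure)"
    unfolding eq by (rule lebesgue_affine_measurable) simp
  have "lebesgue = density (distr lebesgue lebesgue (\<lambda>y::'a. x - y)) (\<lambda>_. 1)"
    using lebesgue_affine_euclidean[of "\<lambda>_. -1" x] unfolding eq by simp
  then have "lebesgue = distr lebesgue lebesgue (\<lambda>y::'a. x - y)"
    by (simp add: density_1)
  moreover assume "f \<in> borel_measurable lebesgue"
  ultimately show "(\<integral>\<^sup>+y. f (x - y) \<partial>lebesgue) = (\<integral>\<^sup>+h. f h \<partial>(lebesgue :: 'a measure))"
    using nn_integral_distr[OF meas, of f] by simp
qed

section \<open>Convexity of powers, and the passage from single scales to norms\<close>

lemma powr_above_tangent: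
  fixes a b p :: real
  assumes "0 < a" "0 \<le> b" "1 \<le> p"
  shows "a powr p + p * a powr (p - 1) * (b - a) \<le> b powr p"
\<comment> \<open>Convexity is used on the open half line, so the boundary value is checked by hand:
  at 0 the tangent has height \<open>(1 - p) * a powr p\<close>, which is at most 0.\<close>
proof (cases "b = 0")
  case True
  have "a powr p = a powr (p - 1) * a"
    using assms by (simp add: powr_mult_base mult.commute)
  then have "a powr p - p * a powr (p - 1) * a = (1 - p) * a powr p" by (simp add: algebra_simps)
  also have "\<dots> \<le> 0" using assms by (simp add: mult_nonpos_nonneg)
  finally show ?thesis using True assms by simp
next
  case False
  have "convex_on {0<..} (\<lambda>x. x powr p)"
    using assms(3) by (rule powr_convex)
  moreover have "((\<lambda>x. x powr p) has_field_derivative p * a powr (p - 1)) (at a within {0<..})"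
    using assms by (auto intro!: derivative_eq_intros simp: field_simps powr_diff)
  ultimately have "b powr p - a powr p \<ge> p * a powr (p - 1) * (b - a)"
    using assms False by (intro convex_on_imp_above_tangent[where A="{0<..}"]) (auto simp: interior_open connected_Ioi)
  then show ?thesis by simp
qed

lemma powr_add_le:
  fixes a b p :: real
  assumes "0 \<le> a" "0 \<le> b" "0 \<le> p"
  shows "(a + b) powr p \<le> 2 powr p * (a powr p + b powr p)"
proof -
  have "(a + b) powr p \<le> (2 * max a b) powr p" using assms by (intro powr_mono2) auto
  also have "\<dots> = 2 powr p * max a b powr p" using assms by (simp add: powr_mult)
  also have "\<dots> \<le> 2 powr p * (a powr p + b powr p)" by (intro mult_left_mono) (auto simp: max_def)
  finally show ?thesis .
qed

lemma ennreal_powr_mono: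
  "0 \<le> a \<Longrightarrow> s \<le> t \<Longrightarrow> ennreal_powr s a \<le> ennreal_powr t a"
  unfolding ennreal_powr_def
  by (auto intro!: ennreal_leI powr_mono2 simp: enn2real_mono top_unique less_top)

lemma ennreal_powr_ennreal: "0 \<le> t \<Longrightarrow> ennreal_powr (ennreal t) a = ennreal (t powr a)"
  by (simp add: ennreal_powr_def)

text \<open>Integrating the tangent line of the power at \<bar>c\<bar> gives the bound. The linear
  term contributes a nonnegative amount because \<bar>c\<bar> is at most the average of
  \<bar>f\<bar>.\<close>

lemma jensen_mean_powr:
  fixes f :: "'a \<Rightarrow> real"
  assumes "finite_measure M" and f: "integrable M f" and p: "1 \<le> p"
    and c: "c = (\<integral>y. f y \<partial>M) / measure M (space M)" and M: "0 < measure M (space M)"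
  shows "ennreal (\<bar>c\<bar> powr p * measure M (space M)) \<le> (\<integral>\<^sup>+y. ennreal (\<bar>f y\<bar> powr p) \<partial>M)"
proof (cases "c = 0 \<or> (\<integral>\<^sup>+y. ennreal (\<bar>f y\<bar> powr p) \<partial>M) = \<infinity>")
  case True
  then show ?thesis by auto
next
  case False
  interpret finite_measure M by fact
  let ?a = "\<bar>c\<bar>" and ?m = "measure M (space M)"
  have a: "0 < ?a" using False by simp
  have [measurable]: "f \<in> borel_measurable M" using f by auto
  have int: "integrable M (\<lambda>y. \<bar>f y\<bar> powr p)"
    using False by (intro integrableI_bounded) (auto simp: less_top)
  have "?a * ?m \<le> (\<integral>y. \<bar>f y\<bar> \<partial>M)"
    using M integral_abs_bound[of M f] by (simp add: c abs_mult)
  then have "?a powr p * ?m \<le> ?a powr p * ?m + p * ?a powr (p - 1) * ((\<integral>y. \<bar>f y\<bar> \<partial>M) - ?a * ?m)"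
    using p by simp
  also have "\<dots> = (\<integral>y. ?a powr p + p * ?a powr (p - 1) * (\<bar>f y\<bar> - ?a) \<partial>M)"
    using f by (simp add: algebra_simps)
  also have "\<dots> \<le> (\<integral>y. \<bar>f y\<bar> powr p \<partial>M)"
    using f int a p by (intro integral_mono powr_above_tangent) auto
  finally have "ennreal (?a powr p * ?m) \<le> ennreal (\<integral>y. \<bar>f y\<bar> powr p \<partial>M)"
    by (rule ennreal_leI)
  also have "\<dots> = (\<integral>\<^sup>+y. ennreal (\<bar>f y\<bar> powr p) \<partial>M)"
    using int by (intro nn_integral_eq_integral[symmetric]) auto
  finally show ?thesis .
qed

lemma integrable_of_Lp:
  fixes f :: "'a \<Rightarrow> real"
  assumes "finite_measure M" and [measurable]: "f \<in> borel_measurable M" and p: "1 \<le> p"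
    and fin: "(\<integral>\<^sup>+y. ennreal (\<bar>f y\<bar> powr p) \<partial>M) < \<infinity>"
  shows "integrable M f"
proof -
  interpret finite_measure M by fact
  have int: "integrable M (\<lambda>y. \<bar>f y\<bar> powr p)"
    using fin by (intro integrableI_bounded) (auto simp: less_top)
  have le: "\<bar>f y\<bar> \<le> 1 + \<bar>f y\<bar> powr p" for y
  proof (cases "\<bar>f y\<bar> \<le> 1")
    case False
    then have "\<bar>f y\<bar> powr 1 \<le> \<bar>f y\<bar> powr p" using p by (intro powr_mono) auto
    then show ?thesis by simp
  qed (simp add: add_increasing2)
  show ?thesis
    by (rule Bochner_Integration.integrable_bound[where f="\<lambda>y. 1 + \<bar>f y\<bar> powr p"])
       (use int le in \<open>auto intro!: AE_I2 order_trans[OF le] \<close>)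
qed

text \<open>The Sobolev bounds are proved one scale at a time; this turns them into a norm
  inequality. If the energy is positive and finite, the scale with
  \<open>\<E> = K * l powr p\<close> is optimal. If it is 0, every scale is admissible and
  \<open>N\<close> vanishes. If it is infinite, the right side is infinite because its coefficient
  is positive.\<close>

lemma le_ennreal_powr_of_scales:
  assumes "0 < a" "0 < K" "0 < p"
    and *: "\<And>l. 0 < l \<Longrightarrow> \<E> \<le> ennreal (K * l powr p) \<Longrightarrow> N \<le> ennreal (a * l)"
  shows "N \<le> ennreal (a * (1 / K) powr (1 / p)) * ennreal_powr \<E> (1 / p)"
proof (cases \<E>)
  case top
  have "0 < a * (1 / K) powr (1 / p)" using assms(1,2) by (intro mult_pos_pos) auto
  then have "ennreal (a * (1 / K) powr (1 / p)) \<noteq> 0" by (simp add: ennreal_eq_0_iff not_le del: zero_less_mult_iff)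
  then have "ennreal (a * (1 / K) powr (1 / p)) * \<infinity> = \<infinity>" by simp
  then show ?thesis using top by (simp add: ennreal_powr_def)
next
  case (real e)
  show ?thesis
  proof (cases "e = 0")
    case True
    have "N \<le> ennreal \<epsilon>" if "0 < \<epsilon>" for \<epsilon>
      using *[of "\<epsilon> / a"] that assms(1) real True by simp
    then have "N \<le> 0" using ennreal_le_epsilon[of 0 N] by simp
    then show ?thesis by simp
  next
    case False
    then have e: "0 < e" using real by simp
    define l where "l = (e / K) powr (1 / p)"
    have "K * l powr p = e" unfolding l_def using assms(2,3) e by (simp add: powr_powr)
    moreover have "0 < l" using e assms(2) by (simp add: l_def)
    ultimately have "N \<le> ennreal (a * l)" using real by (intro *) auto
    also have "l = (1 / K) powr (1 / p) * e powr (1 / p)"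
      unfolding l_def using e assms(2) powr_mult[of "1/K" e "1/p"] by simp
    finally show ?thesis using real assms(1) by (simp add: ennreal_powr_ennreal ennreal_mult'[symmetric] mult.assoc)
  qed
qed

section \<open>Sobolev inequality on the whole space\<close>

text \<open>The function \<open>g\<close> is a real-valued Orlicz function. The setting covers both
  \<open>phi\<close> and a multiple of \<open>t powr pstar\<close>, so the rearrangement of the
  fractional kernel never has to be computed. \<open>g_scale\<close> is convexity of
  \<open>g (t powr (1 / p))\<close> along segments from 0, \<open>\<nu>_tail\<close> is the link
  between kernel and \<open>g\<close>, and \<open>\<nu>_bounded_below\<close> serves the Poincare
  inequality on bounded sets.\<close>

locale nonlocal_sobolev =
  fixes p :: real and \<nu> :: "'a::euclidean_space \<Rightarrow> real" and g :: "real \<Rightarrow> real" and D :: real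
  assumes p_ge_1: "1 \<le> p"
    and \<nu>_measurable [measurable]: "\<nu> \<in> borel_measurable lebesgue"
    and \<nu>_nonneg: "h \<noteq> 0 \<Longrightarrow> 0 \<le> \<nu> h"
    and \<nu>_bounded_below: "0 < R \<Longrightarrow> \<exists>c>0. \<forall>h. h \<noteq> 0 \<and> norm h \<le> R \<longrightarrow> c \<le> \<nu> h"
    and g_0 [simp]: "g 0 = 0"
    and g_pos: "0 < t \<Longrightarrow> 0 < g t"
    and g_scale: "0 < c \<Longrightarrow> c \<le> 1 \<Longrightarrow> 0 < t \<Longrightarrow> g (c * t) \<le> c powr p * g t"
    and D_pos: "0 < D"
    and g_doubling: "0 < t \<Longrightarrow> g (4 * t) \<le> D * g t"
    and \<nu>_tail: "0 < t \<Longrightarrow> F \<in> sets lebesgue \<Longrightarrow> emeasure lebesgue F \<le> ennreal (1 / g t) \<Longrightarrow>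
      ennreal (g t / t powr p) \<le> (\<integral>\<^sup>+h\<in>- F. ennreal (\<nu> h) \<partial>lebesgue)"
begin

lemma g_nonneg: "0 \<le> t \<Longrightarrow> 0 \<le> g t"
  using g_pos[of t] by (cases "t = 0") auto

lemma g_mono:
  assumes "0 \<le> s" "s \<le> t"
  shows "g s \<le> g t"
proof (cases "s = 0")
  case True
  then show ?thesis using assms g_nonneg[of t] by simp
next
  case False
  then have *: "0 < s / t" "s / t \<le> 1" "0 < t" using assms by auto
  have "g s \<le> (s / t) powr p * g t" using g_scale[OF *] * by simp
  also have "\<dots> \<le> 1 * g t"
    using * p_ge_1 g_pos[of t] assms(1) by (intro mult_right_mono powr_le1) auto
  finally show ?thesis by simp
qed

lemma modular_measurable [measurable (raw)]:
  assumes [measurable]: "u \<in> borel_measurable M" and "0 < l"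
  shows "(\<lambda>x. g (\<bar>u x\<bar> / l)) \<in> borel_measurable M"
proof -
  \<comment> \<open>Nothing is known about \<open>g\<close> on negative numbers, so monotonicity is
    applied to its composition with \<open>max 0\<close>.\<close>
  have [measurable]: "(\<lambda>t. g (max 0 t)) \<in> borel_measurable borel"
    by (intro borel_measurable_mono monoI g_mono) auto
  have "(\<lambda>x. g (max 0 (\<bar>u x\<bar> / l))) \<in> borel_measurable M" by measurable
  then show ?thesis using \<open>0 < l\<close> by simp
qed

lemma energy_density_ge:
  assumes [measurable]: "v \<in> borel_measurable lebesgue" and l: "0 < l"
    and I: "(\<integral>\<^sup>+y. ennreal (g (\<bar>v y\<bar> / l)) \<partial>lebesgue) \<le> 1"
  shows "ennreal (l powr p * g (\<bar>v x\<bar> / (2 * l)))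
    \<le> (\<integral>\<^sup>+y. ennreal (\<bar>v x - v y\<bar> powr p * \<nu> (x - y)) \<partial>lebesgue)"
proof (cases "v x = 0")
  case True
  then show ?thesis by simp
next
  case False
  define \<tau> where "\<tau> = \<bar>v x\<bar>"
  define t where "t = \<tau> / (2 * l)"
  define F where "F = {y. \<tau> / 2 < \<bar>v y\<bar>}"
  \<comment> \<open>The tail hypothesis lives in the difference variable \<open>h = x - y\<close>,
    hence the reflected copy of \<open>F\<close>, which has the same measure.\<close>
  define F' where "F' = {h. x - h \<in> F}"
  note [measurable] = lebesgue_measurable_reflect
  have \<tau>: "0 < \<tau>" and t: "0 < t" using False l by (auto simp: \<tau>_def t_def)
  have F_eq: "F = {y\<in>space lebesgue. \<tau> / 2 < \<bar>v y\<bar>}" by (simp add: F_def)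
  have F [measurable]: "F \<in> sets lebesgue" unfolding F_eq by measurable
  have F'_eq: "F' = (\<lambda>h. x - h) -` F \<inter> space lebesgue" by (auto simp: F'_def)
  have F' [measurable]: "F' \<in> sets lebesgue" unfolding F'_eq by measurable
  have "ennreal (g t) * emeasure lebesgue F = (\<integral>\<^sup>+y. ennreal (g t) * indicator F y \<partial>lebesgue)"
    by (simp add: nn_integral_cmult_indicator)
  also have "\<dots> \<le> (\<integral>\<^sup>+y. ennreal (g (\<bar>v y\<bar> / l)) \<partial>lebesgue)"
    using l t \<tau> by (intro nn_integral_mono)
      (auto simp: F_def t_def field_simps split: split_indicator intro!: ennreal_leI g_mono)
  finally have "ennreal (g t) * emeasure lebesgue F \<le> ennreal (g t) * ennreal (1 / g t)"
    using I g_pos[OF t] by (simp flip: ennreal_mult)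
  then have "emeasure lebesgue F \<le> ennreal (1 / g t)"
    using g_pos[OF t] by (subst (asm) ennreal_mult_le_mult_iff) auto
  moreover have "emeasure lebesgue F' = emeasure lebesgue F"
  proof -
    have "indicator F' (x - y) = (indicator F y :: ennreal)" for y
      by (simp add: F'_def split: split_indicator)
    then show ?thesis
      using nn_integral_lebesgue_reflect[of "indicator F'" x] F F' by simp
  qed
  ultimately have "ennreal (g t / t powr p) \<le> (\<integral>\<^sup>+h\<in>- F'. ennreal (\<nu> h) \<partial>lebesgue)"
    by (intro \<nu>_tail t F') simp
  also have "\<dots> = (\<integral>\<^sup>+y. ennreal (\<nu> (x - y)) * indicator (- F') (x - y) \<partial>lebesgue)"
    by (intro nn_integral_lebesgue_reflect[symmetric]) measurable
  also have "\<dots> = (\<integral>\<^sup>+y. ennreal (\<nu> (x - y)) * indicator (- F) y \<partial>lebesgue)"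
    by (simp add: F'_def indicator_def)
  finally have tail: "ennreal (g t / t powr p)
    \<le> (\<integral>\<^sup>+y. ennreal (\<nu> (x - y)) * indicator (- F) y \<partial>lebesgue)" .
  \<comment> \<open>Off \<open>F\<close> the difference \<bar>v x - v y\<bar> is at least
    \<open>l * t\<close>; its power cancels \<open>t powr p\<close> in the tail bound and leaves
    \<open>l powr p * g t\<close>.\<close>
  have "\<tau> / 2 = l * t" using l by (simp add: t_def)
  then have "l powr p * g t = (\<tau> / 2) powr p * (g t / t powr p)"
    using l t by (simp add: powr_mult)
  then have "ennreal (l powr p * g t) = ennreal ((\<tau> / 2) powr p) * ennreal (g t / t powr p)"
    using g_pos[OF t] by (simp flip: ennreal_mult')
  also have "\<dots> \<le> ennreal ((\<tau> / 2) powr p) * (\<integral>\<^sup>+y. ennreal (\<nu> (x - y)) * indicator (- F) y \<partial>lebesgue)"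
    by (intro mult_left_mono tail) simp
  also have "\<dots> = (\<integral>\<^sup>+y. ennreal ((\<tau> / 2) powr p) * (ennreal (\<nu> (x - y)) * indicator (- F) y) \<partial>lebesgue)"
    by (intro nn_integral_cmult[symmetric]) measurable
  also have "\<dots> \<le> (\<integral>\<^sup>+y. ennreal (\<bar>v x - v y\<bar> powr p * \<nu> (x - y)) \<partial>lebesgue)"
  proof (intro nn_integral_mono)
    fix y
    show "ennreal ((\<tau> / 2) powr p) * (ennreal (\<nu> (x - y)) * indicator (- F) y)
      \<le> ennreal (\<bar>v x - v y\<bar> powr p * \<nu> (x - y))"
    proof (cases "y \<in> F")
      case False
      then have y: "\<bar>v y\<bar> \<le> \<tau> / 2" by (simp add: F_def)
      \<comment> \<open>The diagonal lies inside \<open>F\<close>, so the value of the kernel at 0,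
        whose sign is unknown, does not enter.\<close>
      then have "x - y \<noteq> 0" using \<tau> by (auto simp: \<tau>_def)
      then have "0 \<le> \<nu> (x - y)" by (rule \<nu>_nonneg)
      moreover have "(\<tau> / 2) powr p \<le> \<bar>v x - v y\<bar> powr p"
        using p_ge_1 \<tau> y[unfolded \<tau>_def] unfolding \<tau>_def by (intro powr_mono2) linarith+
      ultimately show ?thesis using False
        by (auto simp flip: ennreal_mult intro!: ennreal_leI mult_right_mono)
    qed simp
  qed
  finally show ?thesis by (simp add: t_def \<tau>_def)
qed

text \<open>Passing from \<open>2 * l\<close> in the density bound to \<open>l / 2\<close>
  multiplies the argument of \<open>g\<close> by 4, which is the factor in the doubling property.
  The constant \<open>D\<close> is paid for by the energy bound, so the conclusion is again at most
  1 and nothing accumulates when the step is iterated.\<close>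

lemma modular_halve:
  assumes v: "v \<in> borel_measurable lebesgue" and l: "0 < l"
    and I: "(\<integral>\<^sup>+y. ennreal (g (\<bar>v y\<bar> / l)) \<partial>lebesgue) \<le> 1"
    and E: "nonlocal_energy p \<nu> UNIV v \<le> ennreal (l powr p / D)"
  shows "(\<integral>\<^sup>+y. ennreal (g (\<bar>v y\<bar> / (l / 2))) \<partial>lebesgue) \<le> 1"
proof -
  note [measurable] = v
  let ?c = "l powr p / D"
  have c: "0 < ?c" using l D_pos by simp
  have le: "?c * g (\<bar>v x\<bar> / (l / 2)) \<le> l powr p * g (\<bar>v x\<bar> / (2 * l))" for x
  proof (cases "v x = 0")
    case False
    then have "g (4 * (\<bar>v x\<bar> / (2 * l))) \<le> D * g (\<bar>v x\<bar> / (2 * l))" using l by (intro g_doubling) auto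
    moreover have "4 * (\<bar>v x\<bar> / (2 * l)) = \<bar>v x\<bar> / (l / 2)" by simp
    ultimately have "g (\<bar>v x\<bar> / (l / 2)) \<le> D * g (\<bar>v x\<bar> / (2 * l))" by metis
    then have "?c * g (\<bar>v x\<bar> / (l / 2)) \<le> ?c * (D * g (\<bar>v x\<bar> / (2 * l)))"
      using c by (intro mult_left_mono) auto
    then show ?thesis using D_pos by simp
  qed simp
  have "ennreal ?c * (\<integral>\<^sup>+y. ennreal (g (\<bar>v y\<bar> / (l / 2))) \<partial>lebesgue)
    = (\<integral>\<^sup>+y. ennreal ?c * ennreal (g (\<bar>v y\<bar> / (l / 2))) \<partial>lebesgue)"
    using l by (intro nn_integral_cmult[symmetric]) measurable
  also have "\<dots> \<le> (\<integral>\<^sup>+x. (\<integral>\<^sup>+y. ennreal (\<bar>v x - v y\<bar> powr p * \<nu> (x - y)) \<partial>lebesgue) \<partial>lebesgue)"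
  proof (intro nn_integral_mono)
    fix x
    have "ennreal ?c * ennreal (g (\<bar>v x\<bar> / (l / 2))) \<le> ennreal (l powr p * g (\<bar>v x\<bar> / (2 * l)))"
      using c l le[of x] by (simp flip: ennreal_mult' add: ennreal_leI)
    also note energy_density_ge[OF v l I]
    finally show "ennreal ?c * ennreal (g (\<bar>v x\<bar> / (l / 2)))
      \<le> (\<integral>\<^sup>+y. ennreal (\<bar>v x - v y\<bar> powr p * \<nu> (x - y)) \<partial>lebesgue)" .
  qed
  also have "\<dots> \<le> ennreal ?c * 1"
    using E unfolding nonlocal_energy_def lebesgue_on_UNIV_eq by simp
  finally show ?thesis using c by (subst (asm) ennreal_mult_le_mult_iff) auto
qed

text \<open>Finiteness only starts the descent; its value does not survive. Since \<open>p\<close>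
  is at least 1, dividing the argument by \<open>2 ^ n\<close> divides \<open>g\<close> by at least
  \<open>2 ^ n\<close>, so the modular is at most 1 at scale \<open>2 ^ n * l\<close> for large
  \<open>n\<close>. Then \<open>n\<close> halvings lead back to \<open>l\<close>; the energy
  condition at \<open>l\<close> implies the one at every larger scale.\<close>

lemma sobolev_modular_finite:
  assumes v: "v \<in> borel_measurable lebesgue" and l: "0 < l"
    and I: "(\<integral>\<^sup>+y. ennreal (g (\<bar>v y\<bar> / l)) \<partial>lebesgue) < \<infinity>"
    and E: "nonlocal_energy p \<nu> UNIV v \<le> ennreal (l powr p / D)"
  shows "(\<integral>\<^sup>+y. ennreal (g (\<bar>v y\<bar> / l)) \<partial>lebesgue) \<le> 1"
proof -
  note [measurable] = v
  let ?I = "\<lambda>n. (\<integral>\<^sup>+y. ennreal (g (\<bar>v y\<bar> / (2 ^ n * l))) \<partial>lebesgue)"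
  obtain i where i: "(\<integral>\<^sup>+y. ennreal (g (\<bar>v y\<bar> / l)) \<partial>lebesgue) = ennreal i" "0 \<le> i"
    using I by (cases "(\<integral>\<^sup>+y. ennreal (g (\<bar>v y\<bar> / l)) \<partial>lebesgue)") auto
  obtain n where n: "i < 2 ^ n" using real_arch_pow[of 2 i] by auto
  have le: "2 ^ n * g (\<bar>v y\<bar> / (2 ^ n * l)) \<le> g (\<bar>v y\<bar> / l)" for y
  proof (cases "v y = 0")
    case False
    let ?a = "1 / 2 ^ n :: real"
    have "g (\<bar>v y\<bar> / (2 ^ n * l)) = g (?a * (\<bar>v y\<bar> / l))" by simp
    also have "\<dots> \<le> ?a powr p * g (\<bar>v y\<bar> / l)"
      using False l by (intro g_scale) auto
    also have "\<dots> \<le> ?a powr 1 * g (\<bar>v y\<bar> / l)"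
      using p_ge_1 l by (intro mult_right_mono powr_mono' g_nonneg) auto
    finally show ?thesis by (simp add: field_simps)
  qed simp
  have "ennreal (2 ^ n) * ?I n = (\<integral>\<^sup>+y. ennreal (2 ^ n) * ennreal (g (\<bar>v y\<bar> / (2 ^ n * l))) \<partial>lebesgue)"
    using l by (intro nn_integral_cmult[symmetric]) measurable
  also have "\<dots> \<le> (\<integral>\<^sup>+y. ennreal (g (\<bar>v y\<bar> / l)) \<partial>lebesgue)"
    using le by (intro nn_integral_mono) (simp flip: ennreal_mult' add: ennreal_leI)
  also have "\<dots> \<le> ennreal (2 ^ n) * 1" using i n by (simp add: ennreal_leI)
  finally have "?I n \<le> 1" by (subst (asm) ennreal_mult_le_mult_iff) auto
  then have "?I 0 \<le> 1"
  proof (induction n)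
    case (Suc n)
    have "(1::real) * l \<le> 2 ^ Suc n * l" using l by (intro mult_right_mono one_le_power) auto
    then have "l powr p / D \<le> (2 ^ Suc n * l) powr p / D"
      using l D_pos p_ge_1 by (intro divide_right_mono powr_mono2) auto
    with E have "nonlocal_energy p \<nu> UNIV v \<le> ennreal ((2 ^ Suc n * l) powr p / D)"
      using ennreal_leI order_trans by blast
    then have "(\<integral>\<^sup>+y. ennreal (g (\<bar>v y\<bar> / ((2 ^ Suc n * l) / 2))) \<partial>lebesgue) \<le> 1"
      using Suc.prems l by (intro modular_halve v) auto
    then show ?case by (intro Suc.IH) simp
  qed
  then show ?thesis by simp
qed

text \<open>Applied to truncations, which are 1-Lipschitz functions of \<open>u\<close>. On the
  diagonal both integrands vanish, which settles the one place where the kernel may be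
  negative.\<close>

lemma nonlocal_energy_mono:
  assumes "\<And>x y. x \<in> \<Omega> \<Longrightarrow> y \<in> \<Omega> \<Longrightarrow> \<bar>v x - v y\<bar> \<le> \<bar>u x - u y\<bar>"
  shows "nonlocal_energy p \<nu> \<Omega> v \<le> nonlocal_energy p \<nu> \<Omega> u"
  unfolding nonlocal_energy_def
proof (intro nn_integral_mono ennreal_leI)
  fix x y assume "x \<in> space (lebesgue_on \<Omega>)" "y \<in> space (lebesgue_on \<Omega>)"
  then have "\<bar>v x - v y\<bar> powr p \<le> \<bar>u x - u y\<bar> powr p"
    using assms p_ge_1 by (intro powr_mono2) auto
  then show "\<bar>v x - v y\<bar> powr p * \<nu> (x - y) \<le> \<bar>u x - u y\<bar> powr p * \<nu> (x - y)"
    using \<nu>_nonneg[of "x - y"] by (cases "x = y") (auto intro: mult_right_mono)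
qed

lemma sobolev_modular:
  assumes u: "u \<in> Lp_space p UNIV" and l: "0 < l"
    and E: "nonlocal_energy p \<nu> UNIV u \<le> ennreal (l powr p / D)"
  shows "(\<integral>\<^sup>+x. ennreal (g (\<bar>u x\<bar> / (2 * l))) \<partial>lebesgue) \<le> 1"
proof -
  have [measurable]: "u \<in> borel_measurable lebesgue"
    and fin: "(\<integral>\<^sup>+x. ennreal (\<bar>u x\<bar> powr p) \<partial>lebesgue) < \<infinity>"
    using u by (auto simp: Lp_space_def Lp_integral_def lebesgue_on_UNIV_eq)
  define N where "N n = real (Suc n)" for n
  \<comment> \<open>Cutting at height \<open>N n\<close> makes \<open>v n\<close> bounded;
    subtracting \<open>1 / N n\<close> confines it to a superlevel set of \<bar>u\<bar>, of finite
    measure by Chebyshev's inequality in \<open>L^p\<close>.\<close>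
  define v where "v n x = max 0 (min \<bar>u x\<bar> (N n) - 1 / N n)" for n x
  have N: "0 < N n" "1 \<le> N n" for n by (auto simp: N_def)
  have v [measurable]: "v n \<in> borel_measurable lebesgue" for n
    unfolding v_def by measurable
  have finite_modular: "(\<integral>\<^sup>+x. ennreal (g (\<bar>v n x\<bar> / l)) \<partial>lebesgue) < \<infinity>" for n
  proof -
    let ?S = "{x\<in>space lebesgue. 1 / N n \<le> \<bar>u x\<bar>}"
    have [measurable]: "?S \<in> sets lebesgue" by measurable
    have "ennreal ((1 / N n) powr p) * emeasure lebesgue ?S
        = (\<integral>\<^sup>+x. ennreal ((1 / N n) powr p) * indicator ?S x \<partial>lebesgue)"
      by (intro nn_integral_cmult_indicator[symmetric]) measurable
    also have "\<dots> \<le> (\<integral>\<^sup>+x. ennreal (\<bar>u x\<bar> powr p) \<partial>lebesgue)"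
      using N[of n] p_ge_1 by (intro nn_integral_mono)
        (auto split: split_indicator intro!: ennreal_leI powr_mono2)
    also note fin
    finally have S: "emeasure lebesgue ?S < \<infinity>"
      using N[of n] by (auto simp: ennreal_mult_less_top ennreal_eq_0_iff not_le)
    have "(\<integral>\<^sup>+x. ennreal (g (\<bar>v n x\<bar> / l)) \<partial>lebesgue)
        \<le> (\<integral>\<^sup>+x. ennreal (g (N n / l)) * indicator ?S x \<partial>lebesgue)"
    proof (intro nn_integral_mono)
      fix x
      show "ennreal (g (\<bar>v n x\<bar> / l)) \<le> ennreal (g (N n / l)) * indicator ?S x"
      proof (cases "1 / N n \<le> \<bar>u x\<bar>")
        case True
        have "0 \<le> 1 / N n" using N[of n] by simp
        then have "\<bar>v n x\<bar> \<le> N n" using N[of n] unfolding v_def by linarith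
        then have "g (\<bar>v n x\<bar> / l) \<le> g (N n / l)"
          using l by (intro g_mono divide_right_mono) auto
        then show ?thesis using True by (simp add: ennreal_leI)
      next
        case False
        then have "v n x = 0" by (auto simp: v_def)
        then show ?thesis by simp
      qed
    qed
    also have "\<dots> = ennreal (g (N n / l)) * emeasure lebesgue ?S"
      by (intro nn_integral_cmult_indicator) measurable
    also have "\<dots> < \<infinity>" using S by (simp add: ennreal_mult_less_top)
    finally show ?thesis .
  qed
  have "nonlocal_energy p \<nu> UNIV (v n) \<le> ennreal (l powr p / D)" for n
    by (rule order_trans[OF nonlocal_energy_mono E]) (simp add: v_def max_def min_def abs_if)
  then have modular_v: "(\<integral>\<^sup>+x. ennreal (g (\<bar>v n x\<bar> / l)) \<partial>lebesgue) \<le> 1" for n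
    by (intro sobolev_modular_finite v l finite_modular)
  \<comment> \<open>The truncations eventually dominate half of \<bar>u x\<bar>. Comparing with this
    half rather than with the limit lets monotonicity of \<open>g\<close> replace continuity, at the
    price of a factor 2 in the scale.\<close>
  have "ennreal (g (\<bar>u x\<bar> / (2 * l))) \<le> liminf (\<lambda>n. ennreal (g (\<bar>v n x\<bar> / l)))" for x
  proof (cases "u x = 0")
    case False
    obtain m where m: "max \<bar>u x\<bar> (2 / \<bar>u x\<bar>) < real m" using reals_Archimedean2 by blast
    have "ennreal (g (\<bar>u x\<bar> / (2 * l))) \<le> ennreal (g (\<bar>v n x\<bar> / l))" if "m \<le> n" for n
    proof -
      have n: "\<bar>u x\<bar> < N n" "2 / \<bar>u x\<bar> < N n" using m that by (auto simp: N_def)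
      then have "1 / N n \<le> \<bar>u x\<bar> / 2" using False N[of n] by (auto simp: field_simps)
      then have "\<bar>u x\<bar> / 2 \<le> \<bar>v n x\<bar>" using n by (auto simp: v_def)
      then have "\<bar>u x\<bar> / (2 * l) \<le> \<bar>v n x\<bar> / l" using l by (simp add: field_simps)
      then show ?thesis using l by (intro ennreal_leI g_mono) auto
    qed
    then show ?thesis by (intro Liminf_bounded) (auto simp: eventually_sequentially)
  qed simp
  then have "(\<integral>\<^sup>+x. ennreal (g (\<bar>u x\<bar> / (2 * l))) \<partial>lebesgue)
      \<le> (\<integral>\<^sup>+x. liminf (\<lambda>n. ennreal (g (\<bar>v n x\<bar> / l))) \<partial>lebesgue)"
    by (intro nn_integral_mono)
  also have "\<dots> \<le> liminf (\<lambda>n. \<integral>\<^sup>+x. ennreal (g (\<bar>v n x\<bar> / l)) \<partial>lebesgue)"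
    using l by (intro nn_integral_liminf) measurable
  also have "\<dots> \<le> liminf (\<lambda>n::nat. 1 :: ennreal)"
    by (intro Liminf_mono always_eventually allI modular_v)
  also have "\<dots> = 1" by (simp add: Liminf_const)
  finally show ?thesis .
qed

end

section \<open>Lebesgue spaces on sets of finite measure\<close>

lemma ennreal_powr_le_imp_le:
  assumes "0 < p" "0 \<le> b" "ennreal_powr t (1 / p) \<le> ennreal b"
  shows "t \<le> ennreal (b powr p)"
proof (cases t)
  case top
  then show ?thesis using assms by (simp add: ennreal_powr_def top_unique)
next
  case (real r)
  then have "r powr (1 / p) \<le> b" using assms by (simp add: ennreal_powr_ennreal)
  then have "(r powr (1 / p)) powr p \<le> b powr p" using assms by (intro powr_mono2) auto
  then show ?thesis using real assms by (simp add: powr_powr ennreal_leI)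
qed

lemma nn_integral_lebesgue_on_subset:
  assumes "A \<subseteq> B" "A \<in> sets lebesgue" "B \<in> sets lebesgue"
  shows "(\<integral>\<^sup>+x. f x \<partial>lebesgue_on A) \<le> (\<integral>\<^sup>+x. f x \<partial>lebesgue_on B)"
  using assms by (auto simp: nn_integral_restrict_space intro!: nn_integral_mono split: split_indicator)

lemma finite_measure_lebesgue_on:
  "A \<in> sets lebesgue \<Longrightarrow> emeasure lebesgue A < \<infinity> \<Longrightarrow> finite_measure (lebesgue_on A)"
  by (intro finite_measureI) (simp add: emeasure_restrict_space space_restrict_space)

lemma measure_space_lebesgue_on:
  "A \<in> sets lebesgue \<Longrightarrow> measure (lebesgue_on A) (space (lebesgue_on A)) = measure lebesgue A"
  "A \<in> sets lebesgue \<Longrightarrow> measure (lebesgue_on A) A = measure lebesgue A"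
  by (simp_all add: measure_restrict_space space_restrict_space)

lemma nn_integral_const_lebesgue_on:
  assumes "A \<in> sets lebesgue" "emeasure lebesgue A < \<infinity>" "0 \<le> c"
  shows "(\<integral>\<^sup>+x. ennreal c \<partial>lebesgue_on A) = ennreal (c * measure lebesgue A)"
proof -
  have "emeasure lebesgue A = ennreal (measure lebesgue A)"
    using assms by (intro emeasure_eq_ennreal_measure) auto
  then show ?thesis
    using assms by (simp add: emeasure_restrict_space space_restrict_space ennreal_mult del: emeasure_completion)
qed

lemma nonlocal_energy_diff_const [simp]:
  "nonlocal_energy p \<nu> \<Omega> (\<lambda>x. u x - c) = nonlocal_energy p \<nu> \<Omega> u"
  by (simp add: nonlocal_energy_def)

lemma Lp_space_integrable:
  assumes "\<Omega> \<in> sets lebesgue" "emeasure lebesgue \<Omega> < \<infinity>" "1 \<le> p" "u \<in> Lp_space p \<Omega>"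
  shows "integrable (lebesgue_on \<Omega>) u"
  using assms by (intro integrable_of_Lp[of _ _ p] finite_measure_lebesgue_on) (auto simp: Lp_space_def Lp_integral_def)

lemma Lp_integral_add_le:
  assumes [measurable]: "u \<in> borel_measurable (lebesgue_on \<Omega>)" "v \<in> borel_measurable (lebesgue_on \<Omega>)"
    and "0 \<le> p"
  shows "Lp_integral p \<Omega> (\<lambda>x. u x + v x) \<le> ennreal (2 powr p) * (Lp_integral p \<Omega> u + Lp_integral p \<Omega> v)"
proof -
  have "\<bar>u x + v x\<bar> powr p \<le> 2 powr p * (\<bar>u x\<bar> powr p + \<bar>v x\<bar> powr p)" for x
    using assms(3) by (intro order_trans[OF powr_mono2 powr_add_le]) auto
  then have "Lp_integral p \<Omega> (\<lambda>x. u x + v x)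
      \<le> (\<integral>\<^sup>+x. ennreal (2 powr p) * (ennreal (\<bar>u x\<bar> powr p) + ennreal (\<bar>v x\<bar> powr p)) \<partial>lebesgue_on \<Omega>)"
    unfolding Lp_integral_def
    by (intro nn_integral_mono) (simp flip: ennreal_plus ennreal_mult' add: ennreal_leI)
  also have "\<dots> = ennreal (2 powr p) * (Lp_integral p \<Omega> u + Lp_integral p \<Omega> v)"
    unfolding Lp_integral_def by (simp add: nn_integral_cmult nn_integral_add)
  finally show ?thesis .
qed

lemma Lp_space_diff_const:
  assumes "\<Omega> \<in> sets lebesgue" "emeasure lebesgue \<Omega> < \<infinity>" "1 \<le> p" "u \<in> Lp_space p \<Omega>"
  shows "(\<lambda>x. u x - c) \<in> Lp_space p \<Omega>"
proof -
  have [measurable]: "u \<in> borel_measurable (lebesgue_on \<Omega>)" and u: "Lp_integral p \<Omega> u < \<infinity>"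
    using assms by (auto simp: Lp_space_def)
  have "Lp_integral p \<Omega> (\<lambda>x. u x + - c)
      \<le> ennreal (2 powr p) * (Lp_integral p \<Omega> u + Lp_integral p \<Omega> (\<lambda>_. - c))"
    using assms(3) by (intro Lp_integral_add_le) auto
  also have "Lp_integral p \<Omega> (\<lambda>_. - c) = ennreal (\<bar>c\<bar> powr p * measure lebesgue \<Omega>)"
    using nn_integral_const_lebesgue_on[OF assms(1,2), of "\<bar>c\<bar> powr p"] by (simp add: Lp_integral_def)
  also have "ennreal (2 powr p) * (Lp_integral p \<Omega> u + \<dots>) < \<infinity>"
    using u by (simp add: ennreal_mult_less_top)
  finally show ?thesis by (auto simp: Lp_space_def)
qed

text \<open>By Jensen's inequality the mean is within the \<open>L^p\<close> deviation from
  \<open>c\<close> of any constant \<open>c\<close>. A Poincare inequality with some convenient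
  constant, such as the mean over a subset, therefore suffices.\<close>

lemma Lp_integral_diff_mean_le:
  assumes \<Omega>: "\<Omega> \<in> sets lebesgue" "emeasure lebesgue \<Omega> < \<infinity>" "0 < measure lebesgue \<Omega>"
    and p: "1 \<le> p" and u: "u \<in> Lp_space p \<Omega>"
  shows "Lp_integral p \<Omega> (\<lambda>x. u x - mean \<Omega> u)
    \<le> ennreal (2 powr p * 2) * Lp_integral p \<Omega> (\<lambda>x. u x - c)"
proof -
  let ?m = "mean \<Omega> u"
  interpret finite_measure "lebesgue_on \<Omega>" by (intro finite_measure_lebesgue_on \<Omega>)
  have [measurable]: "u \<in> borel_measurable (lebesgue_on \<Omega>)" using u by (auto simp: Lp_space_def)
  note int = Lp_space_integrable[OF \<Omega>(1,2) p u]
  have "Lp_integral p \<Omega> (\<lambda>_. c - ?m) = ennreal (\<bar>?m - c\<bar> powr p * measure lebesgue \<Omega>)"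
    using nn_integral_const_lebesgue_on[OF \<Omega>(1,2), of "\<bar>?m - c\<bar> powr p"]
    by (simp add: Lp_integral_def abs_minus_commute)
  also have "\<dots> \<le> Lp_integral p \<Omega> (\<lambda>x. u x - c)"
    unfolding Lp_integral_def measure_space_lebesgue_on(1)[OF \<Omega>(1), symmetric]
  proof (rule jensen_mean_powr)
    show "?m - c = (\<integral>y. u y - c \<partial>lebesgue_on \<Omega>) / measure (lebesgue_on \<Omega>) (space (lebesgue_on \<Omega>))"
      using int \<Omega> by (simp add: mean_def measure_space_lebesgue_on diff_divide_distrib)
  qed (use int \<Omega> p in \<open>auto simp: measure_space_lebesgue_on intro: finite_measure_lebesgue_on\<close>)
  finally have const: "Lp_integral p \<Omega> (\<lambda>_. c - ?m) \<le> Lp_integral p \<Omega> (\<lambda>x. u x - c)" .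
  have "Lp_integral p \<Omega> (\<lambda>x. (u x - c) + (c - ?m))
      \<le> ennreal (2 powr p) * (Lp_integral p \<Omega> (\<lambda>x. u x - c) + Lp_integral p \<Omega> (\<lambda>_. c - ?m))"
    using p by (intro Lp_integral_add_le) auto
  also have "\<dots> \<le> ennreal (2 powr p) * (Lp_integral p \<Omega> (\<lambda>x. u x - c) + Lp_integral p \<Omega> (\<lambda>x. u x - c))"
    by (intro mult_left_mono add_left_mono const) simp
  also have "\<dots> = ennreal (2 powr p * 2) * Lp_integral p \<Omega> (\<lambda>x. u x - c)"
    by (simp add: ennreal_mult mult.assoc flip: mult_2)
  finally show ?thesis by simp
qed

lemma exhaust_finite_measure:
  fixes \<Omega> :: "'a::euclidean_space set"
  assumes \<Omega>: "\<Omega> \<in> sets lebesgue" "emeasure lebesgue \<Omega> < \<infinity>" and "0 < \<epsilon>"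
  shows "\<exists>R0. \<forall>R\<ge>R0. measure lebesgue (\<Omega> - cball 0 R) < \<epsilon>"
proof -
  have "(\<lambda>n. measure lebesgue (\<Omega> - cball 0 (real n))) \<longlonglongrightarrow> measure lebesgue (\<Inter>n. \<Omega> - cball 0 (real n))"
  proof (rule Lim_measure_decseq)
    show "range (\<lambda>n. \<Omega> - cball 0 (real n)) \<subseteq> sets lebesgue" using \<Omega> by auto
    show "decseq (\<lambda>n. \<Omega> - cball 0 (real n))" by (auto simp: decseq_def)
    show "emeasure lebesgue (\<Omega> - cball 0 (real n)) \<noteq> \<infinity>" for n
      using emeasure_mono[of "\<Omega> - cball 0 (real n)" \<Omega> lebesgue] \<Omega> by (auto simp: top_unique)
  qed
  moreover have "(\<Inter>n. \<Omega> - cball 0 (real n)) = {}"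
    using real_arch_simple by (auto simp: not_le)
  ultimately have "(\<lambda>n. measure lebesgue (\<Omega> - cball 0 (real n))) \<longlonglongrightarrow> 0" by (simp only: measure_empty)
  then have "\<forall>\<^sub>F n in sequentially. measure lebesgue (\<Omega> - cball 0 (real n)) < \<epsilon>"
    using \<open>0 < \<epsilon>\<close> by (rule order_tendstoD(2))
  then obtain n where n: "measure lebesgue (\<Omega> - cball 0 (real n)) < \<epsilon>"
    by (auto simp: eventually_sequentially)
  have "\<Omega> \<in> lmeasurable" using \<Omega> by (intro fmeasurableI)
  then have "measure lebesgue (\<Omega> - cball 0 R) \<le> measure lebesgue (\<Omega> - cball 0 (real n))" if "real n \<le> R" for R
    using that by (intro measure_mono_fmeasurable fmeasurable_Diff) auto
  then show ?thesis using n by (meson order_le_less_trans)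
qed

lemma measure_open_pos:
  fixes S :: "'a::euclidean_space set"
  assumes "open S" "S \<noteq> {}" "emeasure lebesgue S < \<infinity>"
  shows "0 < measure lebesgue S"
proof -
  have "\<not> negligible S" using assms open_not_negligible by blast
  then have "emeasure lebesgue S \<noteq> 0" using assms by (simp add: negligible_iff_null_sets null_sets_def)
  then show ?thesis using assms by (auto simp: measure_def enn2real_positive_iff zero_less_iff_neq_zero)
qed

section \<open>Extension domains and the Poincare inequality\<close>

context nonlocal_sobolev
begin

lemma extension_modular:
  assumes "nonlocal_extension_domain p \<nu> \<Omega>"
  shows "\<exists>K>0. \<forall>v\<in>nonlocal_space p \<nu> \<Omega>. \<forall>l>0.
    Lp_integral p \<Omega> v + nonlocal_energy p \<nu> \<Omega> v \<le> ennreal (K * l powr p) \<longrightarrow>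
    (\<integral>\<^sup>+x. ennreal (g (\<bar>v x\<bar> / l)) \<partial>lebesgue_on \<Omega>) \<le> 1"
proof -
  obtain E :: "('a \<Rightarrow> real) \<Rightarrow> 'a \<Rightarrow> real" and C0 :: real where "open \<Omega>"
    and E: "\<And>v. v \<in> nonlocal_space p \<nu> \<Omega> \<Longrightarrow> E v \<in> nonlocal_space p \<nu> UNIV"
      "\<And>v. v \<in> nonlocal_space p \<nu> \<Omega> \<Longrightarrow> AE x in lebesgue_on \<Omega>. E v x = v x"
      "\<And>v. v \<in> nonlocal_space p \<nu> \<Omega> \<Longrightarrow>
        nonlocal_norm p \<nu> UNIV (E v) \<le> ennreal C0 * nonlocal_norm p \<nu> \<Omega> v"
    using assms unfolding nonlocal_extension_domain_def by blast
  have \<Omega>: "\<Omega> \<in> sets lebesgue" using \<open>open \<Omega>\<close> by simp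
  \<comment> \<open>The constant of the extension operator may be nonpositive; this replacement can
    be inverted.\<close>
  define C where "C = max C0 1"
  have C: "0 < C" "C0 \<le> C" by (auto simp: C_def)
  \<comment> \<open>The 2 compensates the scale lost in \<open>sobolev_modular\<close>, which is
    applied to \<open>E v\<close> at scale \<open>l / 2\<close>.\<close>
  define K where "K = 1 / ((2 * C) powr p * D)"
  have K: "0 < K" using C D_pos by (simp add: K_def)
  have "(\<integral>\<^sup>+x. ennreal (g (\<bar>v x\<bar> / l)) \<partial>lebesgue_on \<Omega>) \<le> 1"
    if v: "v \<in> nonlocal_space p \<nu> \<Omega>" and l: "0 < l"
      and le: "Lp_integral p \<Omega> v + nonlocal_energy p \<nu> \<Omega> v \<le> ennreal (K * l powr p)" for v l
  proof -
    have "nonlocal_norm p \<nu> UNIV (E v) \<le> ennreal C0 * nonlocal_norm p \<nu> \<Omega> v"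
      by (rule E(3)[OF v])
    also have "\<dots> \<le> ennreal C * ennreal_powr (ennreal (K * l powr p)) (1 / p)"
      unfolding nonlocal_norm_def using C p_ge_1 le
      by (intro mult_mono ennreal_powr_mono ennreal_leI) auto
    also have "\<dots> = ennreal (C * (K * l powr p) powr (1 / p))"
      using C K by (subst ennreal_powr_ennreal) (simp_all flip: ennreal_mult)
    finally have "Lp_integral p UNIV (E v) + nonlocal_energy p \<nu> UNIV (E v)
        \<le> ennreal ((C * (K * l powr p) powr (1 / p)) powr p)"
      unfolding nonlocal_norm_def using C p_ge_1 by (intro ennreal_powr_le_imp_le) auto
    also have "(C * (K * l powr p) powr (1 / p)) powr p = (l / 2) powr p / D"
    proof -
      have "(C * (K * l powr p) powr (1 / p)) powr p = C powr p * (K * l powr p)"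
        using C K l p_ge_1 by (simp add: powr_mult powr_powr)
      also have "\<dots> = (l / 2) powr p / D"
        using C l D_pos by (simp add: K_def powr_mult powr_divide)
      finally show ?thesis .
    qed
    finally have "nonlocal_energy p \<nu> UNIV (E v) \<le> ennreal ((l / 2) powr p / D)"
      by (rule order_trans[rotated]) simp
    then have *: "(\<integral>\<^sup>+x. ennreal (g (\<bar>E v x\<bar> / (2 * (l / 2)))) \<partial>lebesgue) \<le> 1"
      using E(1)[OF v] l by (intro sobolev_modular) (auto simp: nonlocal_space_def)
    have "(\<integral>\<^sup>+x. ennreal (g (\<bar>v x\<bar> / l)) \<partial>lebesgue_on \<Omega>)
        = (\<integral>\<^sup>+x. ennreal (g (\<bar>E v x\<bar> / l)) \<partial>lebesgue_on \<Omega>)"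
      using E(2)[OF v] by (intro nn_integral_cong_AE) auto
    also have "\<dots> \<le> (\<integral>\<^sup>+x. ennreal (g (\<bar>E v x\<bar> / l)) \<partial>lebesgue_on UNIV)"
      using \<Omega> by (intro nn_integral_lebesgue_on_subset) auto
    also have "\<dots> \<le> 1" using * by (simp add: lebesgue_on_UNIV_eq)
    finally show ?thesis .
  qed
  with K show ?thesis by blast
qed

text \<open>Differences of points of \<open>A\<close> stay in a ball on which the kernel is at least
  \<open>c\<close>. Jensen's inequality in \<open>y\<close> for fixed \<open>x\<close> bounds the
  deviation from the mean by the inner energy integral, and integration over \<open>x\<close> gives
  the constant \<open>1 / (c * measure lebesgue A)\<close>.\<close>

lemma poincare_bounded_subset:
  assumes \<Omega>: "\<Omega> \<in> sets lebesgue" "emeasure lebesgue \<Omega> < \<infinity>"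
    and A: "A \<subseteq> \<Omega>" "A \<in> sets lebesgue" "bounded A" "0 < measure lebesgue A"
  shows "\<exists>K>0. \<forall>u\<in>Lp_space p \<Omega>.
    Lp_integral p A (\<lambda>x. u x - mean A u) \<le> ennreal K * nonlocal_energy p \<nu> \<Omega> u"
proof -
  let ?\<mu> = "measure lebesgue A"
  have fin_A: "emeasure lebesgue A < \<infinity>"
    using emeasure_mono[OF A(1) \<Omega>(1)] \<Omega>(2) by (simp add: order_le_less_trans)
  obtain b where b: "0 < b" "\<And>x. x \<in> A \<Longrightarrow> norm x \<le> b"
    using \<open>bounded A\<close> bounded_pos by blast
  obtain c where c: "0 < c" "\<And>h. h \<noteq> 0 \<Longrightarrow> norm h \<le> 2 * b \<Longrightarrow> c \<le> \<nu> h"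
    using \<nu>_bounded_below[of "2 * b"] b(1) by auto
  have "Lp_integral p A (\<lambda>x. u x - mean A u) \<le> ennreal (1 / (c * ?\<mu>)) * nonlocal_energy p \<nu> \<Omega> u"
    if u: "u \<in> Lp_space p \<Omega>" for u
  proof -
    have u_\<Omega> [measurable]: "u \<in> borel_measurable (lebesgue_on \<Omega>)" using u by (auto simp: Lp_space_def)
    have u_A [measurable]: "u \<in> borel_measurable (lebesgue_on A)"
      using u_\<Omega> A(1) by (rule measurable_restrict_mono)
    have "Lp_integral p A u \<le> Lp_integral p \<Omega> u"
      unfolding Lp_integral_def using A \<Omega> by (intro nn_integral_lebesgue_on_subset)
    also have "\<dots> < \<infinity>" using u by (simp add: Lp_space_def)
    finally have "u \<in> Lp_space p A" by (simp add: Lp_space_def)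
    then have int: "integrable (lebesgue_on A) u"
      using A fin_A p_ge_1 by (intro Lp_space_integrable)
    interpret finite_measure "lebesgue_on A" by (intro finite_measure_lebesgue_on A fin_A)
    have pointwise: "ennreal (c * ?\<mu>) * ennreal (\<bar>u x - mean A u\<bar> powr p)
        \<le> (\<integral>\<^sup>+y. ennreal (\<bar>u x - u y\<bar> powr p * \<nu> (x - y)) \<partial>lebesgue_on \<Omega>)" if x: "x \<in> A" for x
    proof -
      have "ennreal (\<bar>u x - mean A u\<bar> powr p * ?\<mu>)
          \<le> (\<integral>\<^sup>+y. ennreal (\<bar>u x - u y\<bar> powr p) \<partial>lebesgue_on A)"
        unfolding measure_space_lebesgue_on(1)[OF A(2), symmetric]
      proof (rule jensen_mean_powr)
        show "u x - mean A u = (\<integral>y. u x - u y \<partial>lebesgue_on A) / measure (lebesgue_on A) (space (lebesgue_on A))"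
          using int A by (simp add: mean_def measure_space_lebesgue_on diff_divide_distrib)
      qed (use int A fin_A p_ge_1 in \<open>auto simp: measure_space_lebesgue_on intro: finite_measure_lebesgue_on\<close>)
      then have "ennreal c * ennreal (\<bar>u x - mean A u\<bar> powr p * ?\<mu>)
          \<le> ennreal c * (\<integral>\<^sup>+y. ennreal (\<bar>u x - u y\<bar> powr p) \<partial>lebesgue_on A)"
        by (intro mult_left_mono) auto
      also have "\<dots> = (\<integral>\<^sup>+y. ennreal c * ennreal (\<bar>u x - u y\<bar> powr p) \<partial>lebesgue_on A)"
        by (intro nn_integral_cmult[symmetric]) measurable
      also have "\<dots> \<le> (\<integral>\<^sup>+y. ennreal (\<bar>u x - u y\<bar> powr p * \<nu> (x - y)) \<partial>lebesgue_on A)"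
      proof (intro nn_integral_mono)
        fix y assume "y \<in> space (lebesgue_on A)"
        then have y: "y \<in> A" by (simp add: space_restrict_space)
        have "c * \<bar>u x - u y\<bar> powr p \<le> \<bar>u x - u y\<bar> powr p * \<nu> (x - y)"
        proof (cases "x = y")
          case False
          then have "c \<le> \<nu> (x - y)"
            using b(2)[OF x] b(2)[OF y] norm_triangle_ineq4[of x y] by (intro c(2)) auto
          then show ?thesis by (subst mult.commute) (rule mult_left_mono, auto)
        qed simp
        then show "ennreal c * ennreal (\<bar>u x - u y\<bar> powr p) \<le> ennreal (\<bar>u x - u y\<bar> powr p * \<nu> (x - y))"
          using c(1) by (simp flip: ennreal_mult add: ennreal_leI)
      qed
      also have "\<dots> \<le> (\<integral>\<^sup>+y. ennreal (\<bar>u x - u y\<bar> powr p * \<nu> (x - y)) \<partial>lebesgue_on \<Omega>)"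
        using A \<Omega> by (intro nn_integral_lebesgue_on_subset)
      finally show ?thesis using c(1) by (simp flip: ennreal_mult add: mult_ac)
    qed
    have "ennreal (c * ?\<mu>) * Lp_integral p A (\<lambda>x. u x - mean A u)
        = (\<integral>\<^sup>+x. ennreal (c * ?\<mu>) * ennreal (\<bar>u x - mean A u\<bar> powr p) \<partial>lebesgue_on A)"
      unfolding Lp_integral_def by (intro nn_integral_cmult[symmetric]) measurable
    also have "\<dots> \<le> (\<integral>\<^sup>+x. (\<integral>\<^sup>+y. ennreal (\<bar>u x - u y\<bar> powr p * \<nu> (x - y)) \<partial>lebesgue_on \<Omega>) \<partial>lebesgue_on A)"
      by (intro nn_integral_mono pointwise) (simp add: space_restrict_space)
    also have "\<dots> \<le> nonlocal_energy p \<nu> \<Omega> u"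
      unfolding nonlocal_energy_def using A \<Omega> by (intro nn_integral_lebesgue_on_subset)
    finally have "ennreal (1 / (c * ?\<mu>)) * (ennreal (c * ?\<mu>) * Lp_integral p A (\<lambda>x. u x - mean A u))
        \<le> ennreal (1 / (c * ?\<mu>)) * nonlocal_energy p \<nu> \<Omega> u"
      by (rule mult_left_mono) simp
    moreover have "ennreal (1 / (c * ?\<mu>)) * ennreal (c * ?\<mu>) = 1"
      using c(1) A(4) by (simp flip: ennreal_mult)
    ultimately show ?thesis by (simp flip: mult.assoc)
  qed
  moreover have "0 < 1 / (c * ?\<mu>)" using c(1) A(4) by simp
  ultimately show ?thesis by blast
qed

text \<open>On an unbounded \<open>\<Omega>\<close> the superlinear growth of \<open>g\<close> against \<open>t powr p\<close> makes the contribution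
  of \<open>\<Omega> - cball 0 R\<close> for large \<open>R\<close> absorbable by the Sobolev inequality, so no compact embedding is needed.\<close>

lemma poincare_Lp_const:
  assumes ext: "nonlocal_extension_domain p \<nu> \<Omega>" and fin: "emeasure lebesgue \<Omega> < \<infinity>" and ne: "\<Omega> \<noteq> {}"
    and growth: "bounded \<Omega> \<or> (\<forall>M. \<exists>T>0. \<forall>t\<ge>T. M * t powr p \<le> g t)"
  shows "\<exists>K>0. \<forall>u\<in>nonlocal_space p \<nu> \<Omega>. \<exists>c.
    Lp_integral p \<Omega> (\<lambda>x. u x - c) \<le> ennreal K * nonlocal_energy p \<nu> \<Omega> u"
proof (cases "bounded \<Omega>")
  case True
  have "open \<Omega>" using ext by (simp add: nonlocal_extension_domain_def)
  then obtain K where "0 < K" "\<And>u. u \<in> Lp_space p \<Omega> \<Longrightarrow>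
      Lp_integral p \<Omega> (\<lambda>x. u x - mean \<Omega> u) \<le> ennreal K * nonlocal_energy p \<nu> \<Omega> u"
    using poincare_bounded_subset[of \<Omega> \<Omega>] True fin measure_open_pos[OF _ ne fin] by auto
  then show ?thesis unfolding nonlocal_space_def by blast
next
  case False
  have "open \<Omega>" using ext by (simp add: nonlocal_extension_domain_def)
  then have \<Omega>: "\<Omega> \<in> sets lebesgue" by simp
  obtain K0 where K0: "0 < K0" and modular: "\<And>v l. v \<in> nonlocal_space p \<nu> \<Omega> \<Longrightarrow> 0 < l \<Longrightarrow>
      Lp_integral p \<Omega> v + nonlocal_energy p \<nu> \<Omega> v \<le> ennreal (K0 * l powr p) \<Longrightarrow>
      (\<integral>\<^sup>+x. ennreal (g (\<bar>v x\<bar> / l)) \<partial>lebesgue_on \<Omega>) \<le> 1"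
    using extension_modular[OF ext] by blast
  \<comment> \<open>Together with \<open>T\<close> and \<open>R\<close> this splits the far
    contribution into two quarters of \<open>K0\<close>: \<open>1 / M\<close> controls values of
    \<bar>v\<bar> / l above \<open>T\<close>, the small measure of \<open>B\<close> controls those
    below.\<close>
  define M where "M = 4 / K0"
  have M: "0 < M" using K0 by (simp add: M_def)
  obtain T where T: "0 < T" "\<And>t. T \<le> t \<Longrightarrow> M * t powr p \<le> g t"
    using growth False by blast
  obtain R0 where R0: "\<And>R. R0 \<le> R \<Longrightarrow> measure lebesgue (\<Omega> - cball 0 R) < K0 / (4 * T powr p)"
    using exhaust_finite_measure[OF \<Omega> fin, of "K0 / (4 * T powr p)"] K0 T(1) by auto
  obtain z where z: "z \<in> \<Omega>" using ne by blast
  \<comment> \<open>The term \<open>norm z + 1\<close> puts \<open>z\<close> inside the open ball,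
    so that \<open>A\<close> has positive measure.\<close>
  define R where "R = max R0 (norm z + 1)"
  define A where "A = \<Omega> \<inter> cball 0 R"
  define B where "B = \<Omega> - cball 0 R"
  have A: "A \<subseteq> \<Omega>" "A \<in> sets lebesgue" "bounded A" using \<Omega> by (auto simp: A_def intro: bounded_subset[OF bounded_cball])
  have B: "B \<subseteq> \<Omega>" "B \<in> sets lebesgue" using \<Omega> by (auto simp: B_def)
  have fin_sub: "emeasure lebesgue S < \<infinity>" if "S \<subseteq> \<Omega>" for S
    using emeasure_mono[OF that \<Omega>] fin by (simp add: order_le_less_trans)
  have "0 < measure lebesgue (\<Omega> \<inter> ball 0 R)"
    using \<open>open \<Omega>\<close> z fin_sub[of "\<Omega> \<inter> ball 0 R"] by (intro measure_open_pos) (auto simp: R_def)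
  also have "\<dots> \<le> measure lebesgue A"
    using \<Omega> fin_sub[OF A(1)] A by (intro measure_mono_fmeasurable) (auto simp: A_def intro!: fmeasurableI)
  finally have A_pos: "0 < measure lebesgue A" .
  have B_small: "T powr p * measure lebesgue B \<le> K0 / 4"
    using R0[of R] T(1) by (simp add: B_def R_def field_simps)
  obtain K1 where K1: "0 < K1" "\<And>u. u \<in> Lp_space p \<Omega> \<Longrightarrow>
      Lp_integral p A (\<lambda>x. u x - mean A u) \<le> ennreal K1 * nonlocal_energy p \<nu> \<Omega> u"
    using poincare_bounded_subset[OF \<Omega> fin A A_pos] by blast
  have "Lp_integral p \<Omega> (\<lambda>x. u x - mean A u) \<le> ennreal (2 * K1 + 1) * nonlocal_energy p \<nu> \<Omega> u"
    if u: "u \<in> nonlocal_space p \<nu> \<Omega>" for u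
  proof -
    define v where "v = (\<lambda>x. u x - mean A u)"
    have u_Lp: "u \<in> Lp_space p \<Omega>" using u by (simp add: nonlocal_space_def)
    have v_Lp: "v \<in> Lp_space p \<Omega>"
      unfolding v_def by (intro Lp_space_diff_const \<Omega> fin p_ge_1 u_Lp)
    have E_v: "nonlocal_energy p \<nu> \<Omega> v = nonlocal_energy p \<nu> \<Omega> u" by (simp add: v_def)
    have v: "v \<in> nonlocal_space p \<nu> \<Omega>" using v_Lp E_v u by (simp add: nonlocal_space_def)
    have v_\<Omega> [measurable]: "v \<in> borel_measurable (lebesgue_on \<Omega>)" using v_Lp by (auto simp: Lp_space_def)
    have v_B [measurable]: "v \<in> borel_measurable (lebesgue_on B)"
      using v_\<Omega> B(1) by (rule measurable_restrict_mono)
    obtain e where e: "nonlocal_energy p \<nu> \<Omega> u = ennreal e" "0 \<le> e"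
      using u by (cases "nonlocal_energy p \<nu> \<Omega> u") (auto simp: nonlocal_space_def)
    obtain a where a: "Lp_integral p \<Omega> v = ennreal a" "0 \<le> a"
      using v_Lp by (cases "Lp_integral p \<Omega> v") (auto simp: Lp_space_def)
    have "a \<le> (2 * K1 + 1) * e"
    proof (cases "a + e = 0")
      case True
      then have "a = 0" "e = 0" using a(2) e(2) by linarith+
      then show ?thesis by simp
    next
      case False
      then have ae: "0 < a + e" using a e by simp
      \<comment> \<open>At this scale the hypothesis of \<open>modular\<close> holds with
        equality.\<close>
      define l where "l = ((a + e) / K0) powr (1 / p)"
      have l: "0 < l" using ae K0 by (simp add: l_def)
      have l_p: "K0 * l powr p = a + e" using ae K0 p_ge_1 by (simp add: l_def powr_powr)
      have "Lp_integral p \<Omega> v + nonlocal_energy p \<nu> \<Omega> v \<le> ennreal (K0 * l powr p)"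
        unfolding l_p E_v using a e by simp
      then have I: "(\<integral>\<^sup>+x. ennreal (g (\<bar>v x\<bar> / l)) \<partial>lebesgue_on \<Omega>) \<le> 1"
        using modular[OF v l] by blast
      have pointwise: "\<bar>v x\<bar> powr p \<le> l powr p * T powr p + l powr p / M * g (\<bar>v x\<bar> / l)" for x
      proof -
        have v_l: "\<bar>v x\<bar> powr p = l powr p * (\<bar>v x\<bar> / l) powr p" using l by (simp add: powr_divide)
        have "(\<bar>v x\<bar> / l) powr p \<le> T powr p + g (\<bar>v x\<bar> / l) / M"
        proof (cases "T \<le> \<bar>v x\<bar> / l")
          case True
          have "(\<bar>v x\<bar> / l) powr p \<le> g (\<bar>v x\<bar> / l) / M" using T(2)[OF True] M by (simp add: field_simps)
          then show ?thesis by (simp add: add_increasing)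
        next
          case False
          then have "(\<bar>v x\<bar> / l) powr p \<le> T powr p" using l p_ge_1 by (intro powr_mono2) auto
          moreover have "0 \<le> g (\<bar>v x\<bar> / l) / M" using M l g_nonneg by auto
          ultimately show ?thesis by linarith
        qed
        then have "l powr p * (\<bar>v x\<bar> / l) powr p \<le> l powr p * (T powr p + g (\<bar>v x\<bar> / l) / M)"
          by (intro mult_left_mono) auto
        then show ?thesis unfolding v_l by (simp add: distrib_left)
      qed
      have "Lp_integral p B v \<le> (\<integral>\<^sup>+x. ennreal (l powr p * T powr p)
          + ennreal (l powr p / M) * ennreal (g (\<bar>v x\<bar> / l)) \<partial>lebesgue_on B)"
        unfolding Lp_integral_def
      proof (intro nn_integral_mono)
        fix x
        have "0 \<le> g (\<bar>v x\<bar> / l)" using l by (intro g_nonneg) auto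
        then show "ennreal (\<bar>v x\<bar> powr p) \<le> ennreal (l powr p * T powr p)
          + ennreal (l powr p / M) * ennreal (g (\<bar>v x\<bar> / l))"
          using pointwise[of x] M by (simp flip: ennreal_plus ennreal_mult add: ennreal_leI)
      qed
      also have "\<dots> = ennreal (l powr p * T powr p * measure lebesgue B)
          + ennreal (l powr p / M) * (\<integral>\<^sup>+x. ennreal (g (\<bar>v x\<bar> / l)) \<partial>lebesgue_on B)"
        using l nn_integral_const_lebesgue_on[OF B(2) fin_sub[OF B(1)], of "l powr p * T powr p"]
        by (subst nn_integral_add, simp, simp, subst nn_integral_cmult) simp_all
      also have "\<dots> \<le> ennreal (l powr p * T powr p * measure lebesgue B) + ennreal (l powr p / M) * 1"
        using I nn_integral_lebesgue_on_subset[OF B \<Omega>, of "\<lambda>x. ennreal (g (\<bar>v x\<bar> / l))"]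
        by (intro add_left_mono mult_left_mono) auto
      also have "\<dots> = ennreal (l powr p * (T powr p * measure lebesgue B + K0 / 4))"
        using M K0 by (simp flip: ennreal_plus add: M_def algebra_simps)
      also have "\<dots> \<le> ennreal (l powr p * (K0 / 4 + K0 / 4))"
        using B_small by (intro ennreal_leI mult_left_mono) auto
      also have "l powr p * (K0 / 4 + K0 / 4) = (a + e) / 2" using l_p by (simp add: mult.commute)
      finally have B_le: "Lp_integral p B v \<le> ennreal ((a + e) / 2)" .
      have A_le: "Lp_integral p A v \<le> ennreal (K1 * e)"
        using K1(2)[OF u_Lp] K1(1) e by (simp add: v_def ennreal_mult)
      have "Lp_integral p \<Omega> v = Lp_integral p A v + Lp_integral p B v"
      proof -
        have "(\<lambda>x. ennreal (\<bar>v x\<bar> powr p) * indicator S x) \<in> borel_measurable lebesgue"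
          if "S \<subseteq> \<Omega>" "S \<in> sets lebesgue" for S
        proof -
          have [measurable]: "v \<in> borel_measurable (lebesgue_on S)"
            using v_\<Omega> that(1) by (rule measurable_restrict_mono)
          have "(\<lambda>x. ennreal (\<bar>v x\<bar> powr p)) \<in> borel_measurable (lebesgue_on S)" by measurable
          then show ?thesis using that(2) by (subst (asm) borel_measurable_restrict_space_iff_ennreal) auto
        qed
        moreover have "(\<lambda>x. ennreal (\<bar>v x\<bar> powr p) * indicator \<Omega> x) =
          (\<lambda>x. ennreal (\<bar>v x\<bar> powr p) * indicator A x + ennreal (\<bar>v x\<bar> powr p) * indicator B x)"
          by (auto simp: A_def B_def indicator_def)
        ultimately show ?thesis using A B \<Omega>
          by (simp add: Lp_integral_def nn_integral_restrict_space nn_integral_add)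
      qed
      also have "\<dots> \<le> ennreal (K1 * e) + ennreal ((a + e) / 2)" by (intro add_mono A_le B_le)
      also have "\<dots> = ennreal (K1 * e + (a + e) / 2)" using K1(1) a e by (simp flip: ennreal_plus)
      finally have "ennreal a \<le> ennreal (K1 * e + (a + e) / 2)" unfolding a(1) .
      moreover have "0 \<le> K1 * e + (a + e) / 2" using a e K1(1) by simp
      ultimately have "a \<le> K1 * e + (a + e) / 2" by (simp only: ennreal_le_iff)
      \<comment> \<open>Half of \<open>a\<close> is absorbed on the left, which is legitimate
        because \<open>a\<close> is a finite real.\<close>
      then show ?thesis by (simp add: field_simps)
    qed
    then have "ennreal a \<le> ennreal ((2 * K1 + 1) * e)" by (rule ennreal_leI)
    then show ?thesis using a(1) e K1(1) by (simp add: v_def ennreal_mult)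
  qed
  moreover have "0 < 2 * K1 + 1" using K1(1) by simp
  ultimately show ?thesis by blast
qed

theorem sobolev_poincare_modular:
  assumes ext: "nonlocal_extension_domain p \<nu> \<Omega>" and fin: "emeasure lebesgue \<Omega> < \<infinity>"
    and growth: "bounded \<Omega> \<or> (\<forall>M. \<exists>T>0. \<forall>t\<ge>T. M * t powr p \<le> g t)"
  shows "\<exists>K>0. \<forall>u\<in>Lp_space p \<Omega>. \<forall>l>0. nonlocal_energy p \<nu> \<Omega> u \<le> ennreal (K * l powr p) \<longrightarrow>
    (\<integral>\<^sup>+x. ennreal (g (\<bar>u x - mean \<Omega> u\<bar> / l)) \<partial>lebesgue_on \<Omega>) \<le> 1"
proof (cases "\<Omega> = {}")
  case True
  then show ?thesis by (intro exI[of _ 1]) (auto simp: nn_integral_restrict_space)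
next
  case False
  have "open \<Omega>" using ext by (simp add: nonlocal_extension_domain_def)
  then have \<Omega>: "\<Omega> \<in> sets lebesgue" by simp
  have pos: "0 < measure lebesgue \<Omega>" using \<open>open \<Omega>\<close> False fin by (rule measure_open_pos)
  obtain K0 where K0: "0 < K0" and modular: "\<And>v l. v \<in> nonlocal_space p \<nu> \<Omega> \<Longrightarrow> 0 < l \<Longrightarrow>
      Lp_integral p \<Omega> v + nonlocal_energy p \<nu> \<Omega> v \<le> ennreal (K0 * l powr p) \<Longrightarrow>
      (\<integral>\<^sup>+x. ennreal (g (\<bar>v x\<bar> / l)) \<partial>lebesgue_on \<Omega>) \<le> 1"
    using extension_modular[OF ext] by blast
  obtain K1 where K1: "0 < K1" "\<And>u. u \<in> nonlocal_space p \<nu> \<Omega> \<Longrightarrow>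
      \<exists>c. Lp_integral p \<Omega> (\<lambda>x. u x - c) \<le> ennreal K1 * nonlocal_energy p \<nu> \<Omega> u"
    using poincare_Lp_const[OF ext fin False growth] by blast
  define K2 where "K2 = 2 powr p * 2 * K1"
  \<comment> \<open>Subtracting the mean leaves the energy unchanged, and the Poincare inequality
    bounds the \<open>L^p\<close> term by \<open>K2\<close> times the energy; the total demanded by
    \<open>modular\<close> is thus \<open>K2 + 1\<close> energies.\<close>
  define K where "K = K0 / (K2 + 1)"
  have K2: "0 < K2" using K1(1) by (simp add: K2_def)
  then have K: "0 < K" "(K2 + 1) * K = K0" using K0 by (auto simp: K_def field_simps)
  have "(\<integral>\<^sup>+x. ennreal (g (\<bar>u x - mean \<Omega> u\<bar> / l)) \<partial>lebesgue_on \<Omega>) \<le> 1"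
    if u: "u \<in> Lp_space p \<Omega>" and l: "0 < l" and E: "nonlocal_energy p \<nu> \<Omega> u \<le> ennreal (K * l powr p)" for u l
  proof (rule modular)
    let ?v = "\<lambda>x. u x - mean \<Omega> u"
    have fin_E: "nonlocal_energy p \<nu> \<Omega> u < \<infinity>" using E by (rule order_le_less_trans) simp
    then show v: "?v \<in> nonlocal_space p \<nu> \<Omega>"
      using Lp_space_diff_const[OF \<Omega> fin p_ge_1 u] by (simp add: nonlocal_space_def)
    obtain c where c: "Lp_integral p \<Omega> (\<lambda>x. u x - c) \<le> ennreal K1 * nonlocal_energy p \<nu> \<Omega> u"
      using K1(2) u fin_E by (auto simp: nonlocal_space_def)
    have "Lp_integral p \<Omega> ?v \<le> ennreal (2 powr p * 2) * Lp_integral p \<Omega> (\<lambda>x. u x - c)"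
      by (intro Lp_integral_diff_mean_le \<Omega> fin pos p_ge_1 u)
    also have "\<dots> \<le> ennreal (2 powr p * 2) * (ennreal K1 * nonlocal_energy p \<nu> \<Omega> u)"
      by (intro mult_left_mono c) simp
    also have "\<dots> = ennreal K2 * nonlocal_energy p \<nu> \<Omega> u"
      using K1(1) by (simp add: K2_def ennreal_mult mult.assoc)
    finally have "Lp_integral p \<Omega> ?v + nonlocal_energy p \<nu> \<Omega> ?v
        \<le> ennreal K2 * nonlocal_energy p \<nu> \<Omega> u + nonlocal_energy p \<nu> \<Omega> u" by (simp add: add_right_mono)
    also have "\<dots> = ennreal (K2 + 1) * nonlocal_energy p \<nu> \<Omega> u"
      using K2 by (simp add: distrib_right)
    also have "\<dots> \<le> ennreal (K2 + 1) * ennreal (K * l powr p)" by (intro mult_left_mono E) simp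
    also have "\<dots> = ennreal ((K2 + 1) * (K * l powr p))"
      using K2 K(1) by (intro ennreal_mult[symmetric]) auto
    also have "(K2 + 1) * (K * l powr p) = K0 * l powr p" using K(2) by (simp flip: mult.assoc)
    finally show "Lp_integral p \<Omega> ?v + nonlocal_energy p \<nu> \<Omega> ?v \<le> ennreal (K0 * l powr p)" .
  qed (rule l)
  with K(1) show ?thesis by blast
qed

end

section \<open>The tail of the kernel and its rearrangement\<close>

text \<open>Bathtub principle: among sets removed, a superlevel set leaves the least mass. The part
  of \<open>E\<close> below the level is no larger than the part of the superlevel set missed by
  \<open>E\<close>, and \<open>f\<close> is at most \<open>s\<close> on the former and above
  \<open>s\<close> on the latter. Finiteness of the measure of \<open>E\<close> allows the common
  part to be cancelled.\<close>

lemma nn_integral_sublevel_le: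
  fixes f :: "'a \<Rightarrow> ennreal"
  assumes f [measurable]: "f \<in> borel_measurable M" and E [measurable]: "E \<in> sets M"
    and fin: "emeasure M E < \<infinity>"
    and le: "emeasure M E \<le> emeasure M {x\<in>space M. s < f x}"
  shows "(\<integral>\<^sup>+x. f x * indicator {x. f x \<le> s} x \<partial>M) \<le> (\<integral>\<^sup>+x. f x * indicator (- E) x \<partial>M)"
proof -
  define U where "U = {x\<in>space M. s < f x}"
  define V where "V = {x\<in>space M. f x \<le> s}"
  have [measurable]: "U \<in> sets M" "V \<in> sets M" unfolding U_def V_def by measurable
  have "emeasure M (U \<inter> E) + emeasure M (V \<inter> E) = emeasure M E"
    using sets.sets_into_space[OF E]
    by (subst plus_emeasure) (auto simp: U_def V_def intro!: arg_cong[where f="emeasure M"])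
  also have "\<dots> \<le> emeasure M U" using le by (simp add: U_def)
  also have "\<dots> = emeasure M (U \<inter> E) + emeasure M (U - E)"
    by (subst plus_emeasure) (auto intro!: arg_cong[where f="emeasure M"])
  finally have VE: "emeasure M (V \<inter> E) \<le> emeasure M (U - E)"
    using fin emeasure_mono[of "U \<inter> E" E M] by (auto simp: ennreal_add_left_cancel_le)
  have "(\<integral>\<^sup>+x. f x * indicator {x. f x \<le> s} x \<partial>M)
      \<le> (\<integral>\<^sup>+x. f x * indicator (V - E) x + s * indicator (V \<inter> E) x \<partial>M)"
    by (intro nn_integral_mono) (auto simp: V_def split: split_indicator)
  also have "\<dots> = (\<integral>\<^sup>+x. f x * indicator (V - E) x \<partial>M) + s * emeasure M (V \<inter> E)"
    by (subst nn_integral_add) (simp_all add: nn_integral_cmult_indicator)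
  also have "\<dots> \<le> (\<integral>\<^sup>+x. f x * indicator (V - E) x \<partial>M) + s * emeasure M (U - E)"
    by (intro add_left_mono mult_left_mono VE) simp
  also have "\<dots> = (\<integral>\<^sup>+x. f x * indicator (V - E) x + s * indicator (U - E) x \<partial>M)"
    by (subst nn_integral_add) (simp_all add: nn_integral_cmult_indicator)
  also have "\<dots> \<le> (\<integral>\<^sup>+x. f x * indicator (- E) x \<partial>M)"
    by (intro nn_integral_mono) (auto simp: V_def U_def split: split_indicator)
  finally show ?thesis .
qed

section \<open>Levels of the rearrangement and the size of \<open>nu_sharp\<close>\<close>

lemma unit_ball_measure_eq: "unit_ball_measure TYPE('a::euclidean_space) = unit_ball_vol (real DIM('a))"
  by (simp add: unit_ball_measure_def content_ball)

lemma unit_ball_measure_pos: "0 < unit_ball_measure TYPE('a::euclidean_space)"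
  by (simp add: unit_ball_measure_eq)

lemma eta_pos: "0 < r \<Longrightarrow> 0 < eta TYPE('a::euclidean_space) r"
  using unit_ball_measure_pos[where 'a='a] by (simp add: eta_def)

text \<open>With radius \<open>eta\<close> of \<open>r\<close>, the rearrangement compares
  superlevel sets with measure exactly \<open>r\<close>.\<close>

lemma eta_power:
  assumes "0 < r"
  shows "unit_ball_measure TYPE('a::euclidean_space) * eta TYPE('a) r ^ DIM('a) = r"
proof -
  have "eta TYPE('a) r ^ DIM('a) = eta TYPE('a) r powr real DIM('a)"
    using eta_pos[OF assms, where 'a='a] by (simp add: powr_realpow)
  also have "\<dots> = r / unit_ball_measure TYPE('a)"
    using assms unit_ball_measure_pos[where 'a='a] by (simp add: eta_def powr_powr)
  finally show ?thesis using unit_ball_measure_pos[where 'a='a] by simp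
qed

lemma nu_sharp_antimono:
  fixes \<nu> :: "'a::euclidean_space \<Rightarrow> real"
  assumes "0 < r" "r \<le> r'"
  shows "nu_sharp \<nu> r' \<le> nu_sharp \<nu> r"
proof -
  have "unit_ball_measure TYPE('a) * eta TYPE('a) r ^ DIM('a)
      \<le> unit_ball_measure TYPE('a) * eta TYPE('a) r' ^ DIM('a)"
    using assms by (simp add: eta_power)
  note le = ennreal_leI[OF this]
  have "sym_rearrangement \<nu> (eta TYPE('a) r') \<le> sym_rearrangement \<nu> (eta TYPE('a) r)"
    unfolding sym_rearrangement_def
  proof (rule Inf_superset_mono, clarify)
    fix s assume "0 < s" "emeasure lebesgue {h. h \<noteq> 0 \<and> s < \<nu> h}
      \<le> ennreal (unit_ball_measure TYPE('a) * eta TYPE('a) r ^ DIM('a))"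
    then show "\<exists>s'. ennreal s = ennreal s' \<and> 0 < s' \<and> emeasure lebesgue {h. h \<noteq> 0 \<and> s' < \<nu> h}
      \<le> ennreal (unit_ball_measure TYPE('a) * eta TYPE('a) r' ^ DIM('a))"
      using order_trans[OF _ le] by (intro exI[of _ s] conjI refl)
  qed
  then show ?thesis
    unfolding nu_sharp_def
    by (intro nn_integral_mono) (auto split: split_indicator)
qed

lemma superlevel_measurable:
  fixes \<nu> :: "'a::euclidean_space \<Rightarrow> real"
  assumes [measurable]: "\<nu> \<in> borel_measurable lebesgue"
  shows "{h. h \<noteq> 0 \<and> s < \<nu> h} \<in> sets lebesgue"
proof -
  have "{h\<in>space lebesgue. s < \<nu> h} - {0} \<in> sets lebesgue"
    by (intro sets.Diff) (measurable, simp)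
  also have "{h\<in>space lebesgue. s < \<nu> h} - {0} = {h. h \<noteq> 0 \<and> s < \<nu> h}" by auto
  finally show ?thesis .
qed

lemma emeasure_superlevel_gt:
  fixes \<nu> :: "'a::euclidean_space \<Rightarrow> real"
  assumes "0 < r" "0 < s" "ennreal s < sym_rearrangement \<nu> (eta TYPE('a) r)"
  shows "ennreal r < emeasure lebesgue {h. h \<noteq> 0 \<and> s < \<nu> h}"
proof (rule ccontr)
  assume "\<not> ?thesis"
  then have "sym_rearrangement \<nu> (eta TYPE('a) r) \<le> ennreal s"
    unfolding sym_rearrangement_def eta_power[OF \<open>0 < r\<close>] using \<open>0 < s\<close>
    by (intro Inf_lower) (auto simp: not_less)
  then show False using assms(3) by simp
qed

text \<open>At any level below the rearrangement the superlevel set has measure above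
  \<open>r\<close>, hence above that of \<open>E\<close>, and the bathtub principle applies. At the
  rearrangement level itself the superlevel set may be too small, so that level is reached as a
  limit.\<close>

lemma nu_sharp_le_nn_integral_Compl:
  fixes \<nu> :: "'a::euclidean_space \<Rightarrow> real"
  assumes \<nu> [measurable]: "\<nu> \<in> borel_measurable lebesgue"
    and r: "0 < r" and E [measurable]: "E \<in> sets lebesgue" "emeasure lebesgue E \<le> ennreal r"
  shows "nu_sharp \<nu> r \<le> (\<integral>\<^sup>+h\<in>- E. ennreal (\<nu> h) \<partial>lebesgue)"
proof -
  \<comment> \<open>The kernel is arbitrary at 0, while the level sets in the rearrangement omit the
    origin.\<close>
  define f where "f h = (if h = 0 then 0 else ennreal (\<nu> h))" for h
  have [measurable]: "{0::'a} \<in> sets lebesgue" by simp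
  have f [measurable]: "f \<in> borel_measurable lebesgue"
  proof -
    have "f = (\<lambda>h. ennreal (\<nu> h) * indicator (- {0}) h)" by (auto simp: f_def)
    then show ?thesis by simp
  qed
  define \<Lambda> where "\<Lambda> = sym_rearrangement \<nu> (eta TYPE('a) r)"
  have E_fin: "emeasure lebesgue E < \<infinity>" using E(2) by (rule order_le_less_trans) simp
  have sub: "(\<integral>\<^sup>+h. f h * indicator {h. f h \<le> s} h \<partial>lebesgue) \<le> (\<integral>\<^sup>+h. f h * indicator (- E) h \<partial>lebesgue)"
    if s: "s < \<Lambda>" for s
  proof -
    \<comment> \<open>The level \<open>s\<close> may be 0, but the rearrangement uses positive real
      levels; an intermediate level is one.\<close>
    obtain s1 where s1: "s < s1" "s1 < \<Lambda>" using dense[OF s] by blast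
    then obtain s' where s': "s1 = ennreal s'" "0 \<le> s'" by (cases s1) auto
    then have "0 < s'" using s1 by (cases "s' = 0") auto
    then have "ennreal r < emeasure lebesgue {h. h \<noteq> 0 \<and> s' < \<nu> h}"
      using s1 s' by (intro emeasure_superlevel_gt r) (auto simp: \<Lambda>_def)
    also have "\<dots> \<le> emeasure lebesgue {h\<in>space lebesgue. s < f h}"
    proof (rule emeasure_mono)
      show "{h\<in>space lebesgue. s < f h} \<in> sets lebesgue" by measurable
      have "s < ennreal (\<nu> h)" if "s' < \<nu> h" for h
        using s1(1) s' \<open>0 < s'\<close> that by (metis ennreal_lessI less_trans)
      then show "{h. h \<noteq> 0 \<and> s' < \<nu> h} \<subseteq> {h\<in>space lebesgue. s < f h}" by (auto simp: f_def)
    qed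
    finally show ?thesis
      using E(2) by (intro nn_integral_sublevel_le E E_fin f) (auto intro: order_trans less_imp_le)
  qed
  have ae: "AE h in lebesgue. h \<noteq> (0::'a)"
    by (rule AE_I[of _ _ "{0}"]) auto
  have "nu_sharp \<nu> r = (\<integral>\<^sup>+h. f h * indicator {h. f h < \<Lambda>} h \<partial>lebesgue)"
    unfolding nu_sharp_def \<Lambda>_def[symmetric]
    by (rule nn_integral_cong_AE, rule eventually_mono[OF ae]) (simp add: f_def indicator_def)
  also have "\<dots> \<le> (\<integral>\<^sup>+h. f h * indicator (- E) h \<partial>lebesgue)"
  proof (cases "\<Lambda> = 0")
    case False
    then obtain s where s: "\<And>n::nat. s n < \<Lambda>" "s \<longlonglongrightarrow> \<Lambda>"
      using approx_from_below_dense_linorder[of 0 \<Lambda>] by (auto simp: zero_less_iff_neq_zero)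
    have "(\<integral>\<^sup>+h. f h * indicator {h. f h < \<Lambda>} h \<partial>lebesgue)
        \<le> (\<integral>\<^sup>+h. liminf (\<lambda>n. f h * indicator {h. f h \<le> s n} h) \<partial>lebesgue)"
    proof (intro nn_integral_mono)
      fix h
      show "f h * indicator {h. f h < \<Lambda>} h \<le> liminf (\<lambda>n. f h * indicator {h. f h \<le> s n} h)"
      proof (cases "f h < \<Lambda>")
        case True
        then have "\<forall>\<^sub>F n in sequentially. f h < s n" using s(2) by (rule order_tendstoD(1)[rotated])
        then have "\<forall>\<^sub>F n in sequentially. f h * indicator {h. f h < \<Lambda>} h \<le> f h * indicator {h. f h \<le> s n} h"
          by (rule eventually_mono) (auto simp: indicator_def)
        then show ?thesis by (rule Liminf_bounded)
      qed simp
    qed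
    also have "\<dots> \<le> liminf (\<lambda>n. \<integral>\<^sup>+h. f h * indicator {h. f h \<le> s n} h \<partial>lebesgue)"
    proof (rule nn_integral_liminf)
      fix n
      have "{h\<in>space lebesgue. f h \<le> s n} \<in> sets lebesgue" by measurable
      then have [measurable]: "{h. f h \<le> s n} \<in> sets lebesgue" by simp
      show "(\<lambda>h. f h * indicator {h. f h \<le> s n} h) \<in> borel_measurable lebesgue" by measurable
    qed
    also have "\<dots> \<le> liminf (\<lambda>n::nat. \<integral>\<^sup>+h. f h * indicator (- E) h \<partial>lebesgue)"
      by (intro Liminf_mono always_eventually allI sub s)
    also have "\<dots> = (\<integral>\<^sup>+h. f h * indicator (- E) h \<partial>lebesgue)" by (simp add: Liminf_const)
    finally show ?thesis .
  qed simp
  also have "\<dots> = (\<integral>\<^sup>+h\<in>- E. ennreal (\<nu> h) \<partial>lebesgue)"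
    by (rule nn_integral_cong_AE, rule eventually_mono[OF ae]) (simp add: f_def)
  finally show ?thesis .
qed

text \<open>Because every superlevel set has positive measure, the cutoff level tends to infinity as
  \<open>r\<close> tends to 0, and the integration sets eventually contain each nonzero point.
  Fatou's lemma then makes a uniform bound on \<open>nu_sharp\<close> contradict the infinite
  integral.\<close>

lemma nu_sharp_unbounded:
  fixes \<nu> :: "'a::euclidean_space \<Rightarrow> real"
  assumes \<nu> [measurable]: "\<nu> \<in> borel_measurable lebesgue"
    and inf: "(\<integral>\<^sup>+h. ennreal (\<nu> h) \<partial>lebesgue) = \<infinity>"
    and unbdd: "\<And>s. 0 < emeasure lebesgue {h. h \<noteq> 0 \<and> s < \<nu> h}"
  shows "\<exists>r>0. ennreal M \<le> nu_sharp \<nu> r"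
proof (rule ccontr)
  assume contr: "\<not> ?thesis"
  define r where "r n = 1 / real (Suc n)" for n
  have r: "0 < r n" for n by (simp add: r_def)
  define A where "A n = {h. h \<noteq> 0 \<and> ennreal (\<nu> h) < sym_rearrangement \<nu> (eta TYPE('a) (r n))}" for n
  have A [measurable]: "A n \<in> sets lebesgue" for n
  proof -
    have "A n = - {0} \<inter> {h\<in>space lebesgue. ennreal (\<nu> h) < sym_rearrangement \<nu> (eta TYPE('a) (r n))}"
      by (auto simp: A_def)
    moreover have "{h\<in>space lebesgue. ennreal (\<nu> h) < sym_rearrangement \<nu> (eta TYPE('a) (r n))} \<in> sets lebesgue"
      by measurable
    moreover have "- {0::'a} \<in> sets lebesgue" by simp
    ultimately show ?thesis by (simp only: sets.Int)
  qed
  have ev: "\<forall>\<^sub>F n in sequentially. h \<in> A n" if "h \<noteq> 0" for h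
  proof -
    \<comment> \<open>A level strictly above the value at \<open>h\<close>: once \<open>r n\<close>
      is below the measure of its superlevel set, no smaller level qualifies in the infimum.\<close>
    define s where "s = \<bar>\<nu> h\<bar> + 1"
    let ?m = "emeasure lebesgue {h. h \<noteq> 0 \<and> s < \<nu> h}"
    have "r \<longlonglongrightarrow> 0"
      using LIMSEQ_Suc[OF lim_1_over_n[where 'a=real]] by (simp add: r_def[abs_def])
    then have "(\<lambda>n. ennreal (r n)) \<longlonglongrightarrow> ennreal 0" by (rule tendsto_ennrealI)
    then have "\<forall>\<^sub>F n in sequentially. ennreal (r n) < ?m"
      by (rule order_tendstoD(2)) (use unbdd[of s] in simp)
    then show ?thesis
    proof (rule eventually_mono)
      fix n assume n: "ennreal (r n) < ?m"
      have "ennreal s \<le> sym_rearrangement \<nu> (eta TYPE('a) (r n))"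
        unfolding sym_rearrangement_def eta_power[OF r]
      proof (rule Inf_greatest, clarify)
        fix s' :: real
        assume s': "emeasure lebesgue {h. h \<noteq> 0 \<and> s' < \<nu> h} \<le> ennreal (r n)"
        show "ennreal s \<le> ennreal s'"
        proof (rule ccontr)
          assume "\<not> ?thesis"
          then have "s' \<le> s" by (meson ennreal_leI linear)
          then have "?m \<le> emeasure lebesgue {h. h \<noteq> 0 \<and> s' < \<nu> h}"
            by (intro emeasure_mono superlevel_measurable \<nu>) auto
          then show False using s' n by simp
        qed
      qed
      moreover have "ennreal (\<nu> h) < ennreal s" by (intro ennreal_lessI) (auto simp: s_def)
      ultimately show "h \<in> A n" using \<open>h \<noteq> 0\<close> by (simp add: A_def)
    qed
  qed
  have "\<infinity> = (\<integral>\<^sup>+h. ennreal (\<nu> h) \<partial>lebesgue)" using inf by simp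
  also have "\<dots> \<le> (\<integral>\<^sup>+h. liminf (\<lambda>n. ennreal (\<nu> h) * indicator (A n) h) \<partial>lebesgue)"
  proof (intro nn_integral_mono_AE)
    have "AE h in lebesgue. h \<noteq> (0::'a)" by (rule AE_I[of _ _ "{0}"]) auto
    then show "AE h in lebesgue. ennreal (\<nu> h) \<le> liminf (\<lambda>n. ennreal (\<nu> h) * indicator (A n) h)"
    proof (rule eventually_mono)
      fix h :: 'a assume "h \<noteq> 0"
      have "\<forall>\<^sub>F n in sequentially. ennreal (\<nu> h) \<le> ennreal (\<nu> h) * indicator (A n) h"
        by (rule eventually_mono[OF ev[OF \<open>h \<noteq> 0\<close>]]) simp
      then show "ennreal (\<nu> h) \<le> liminf (\<lambda>n. ennreal (\<nu> h) * indicator (A n) h)"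
        by (rule Liminf_bounded)
    qed
  qed
  also have "\<dots> \<le> liminf (\<lambda>n. \<integral>\<^sup>+h. ennreal (\<nu> h) * indicator (A n) h \<partial>lebesgue)"
    by (intro nn_integral_liminf) measurable
  also have "\<dots> \<le> liminf (\<lambda>n::nat. ennreal M)"
  proof (intro Liminf_mono always_eventually allI)
    fix n
    have "(\<integral>\<^sup>+h. ennreal (\<nu> h) * indicator (A n) h \<partial>lebesgue) = nu_sharp \<nu> (r n)"
      by (simp add: nu_sharp_def A_def)
    then show "(\<integral>\<^sup>+h. ennreal (\<nu> h) * indicator (A n) h \<partial>lebesgue) \<le> ennreal M"
      using contr r[of n] by (auto simp: not_le intro: less_imp_le)
  qed
  also have "\<dots> < \<infinity>" by (simp add: Liminf_const)
  finally show False by simp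
qed

text \<open>The constant function \<open>1\<close> has finite norm on \<open>\<Omega>\<close>. Its extension vanishes at infinity in the
  \<open>L\<^sup>p\<close> sense, so finiteness of its energy forces \<open>\<nu>\<close> to be integrable off a set of finite measure.\<close>

lemma extension_domain_kernel_unbounded:
  fixes \<nu> :: "'a::euclidean_space \<Rightarrow> real"
  assumes p: "1 \<le> p" and \<nu> [measurable]: "\<nu> \<in> borel_measurable lebesgue"
    and nonneg: "\<And>h. h \<noteq> 0 \<Longrightarrow> 0 \<le> \<nu> h"
    and ext: "nonlocal_extension_domain p \<nu> \<Omega>" and fin: "emeasure lebesgue \<Omega> < \<infinity>" and ne: "\<Omega> \<noteq> {}"
    and inf: "(\<integral>\<^sup>+h. ennreal (\<nu> h) \<partial>lebesgue) = \<infinity>"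
  shows "0 < emeasure lebesgue {h. h \<noteq> 0 \<and> s < \<nu> h}"
proof (rule ccontr)
  assume "\<not> ?thesis"
  then have s0: "emeasure lebesgue {h. h \<noteq> 0 \<and> s < \<nu> h} = 0" by (simp add: not_less)
  note [measurable] = lebesgue_measurable_reflect
  have "open \<Omega>" using ext by (simp add: nonlocal_extension_domain_def)
  then have \<Omega> [measurable]: "\<Omega> \<in> sets lebesgue" by simp
  have one: "(\<lambda>_. 1) \<in> nonlocal_space p \<nu> \<Omega>"
  proof -
    have "(\<integral>\<^sup>+x. ennreal 1 \<partial>lebesgue_on \<Omega>) < \<infinity>"
      by (simp only: nn_integral_const_lebesgue_on[OF \<Omega> fin zero_le_one] ennreal_less_top infinity_ennreal_def)
    then show ?thesis by (simp add: nonlocal_space_def Lp_space_def Lp_integral_def nonlocal_energy_def)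
  qed
  obtain w where w: "w \<in> nonlocal_space p \<nu> UNIV" and w1: "AE x in lebesgue_on \<Omega>. w x = 1"
    using ext one unfolding nonlocal_extension_domain_def by meson
  have w_meas [measurable]: "w \<in> borel_measurable lebesgue"
    and w_Lp: "(\<integral>\<^sup>+x. ennreal (\<bar>w x\<bar> powr p) \<partial>lebesgue) < \<infinity>"
    and w_E: "(\<integral>\<^sup>+x. (\<integral>\<^sup>+y. ennreal (\<bar>w x - w y\<bar> powr p * \<nu> (x - y)) \<partial>lebesgue) \<partial>lebesgue) < \<infinity>"
    using w unfolding nonlocal_space_def Lp_space_def Lp_integral_def nonlocal_energy_def lebesgue_on_UNIV_eq
    by auto
  \<comment> \<open>Off \<open>F\<close> the extension \<open>w\<close> of 1 is at distance at least
    1/2 from the value 1, and \<open>F\<close> has finite measure since \<open>w\<close> is in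
    \<open>L^p\<close>.\<close>
  define F where "F = {x\<in>space lebesgue. 1 / 2 < \<bar>w x\<bar>}"
  have F [measurable]: "F \<in> sets lebesgue" unfolding F_def by measurable
  have "ennreal ((1 / 2) powr p) * emeasure lebesgue F
      = (\<integral>\<^sup>+x. ennreal ((1 / 2) powr p) * indicator F x \<partial>lebesgue)"
    by (intro nn_integral_cmult_indicator[symmetric]) measurable
  also have "\<dots> \<le> (\<integral>\<^sup>+x. ennreal (\<bar>w x\<bar> powr p) \<partial>lebesgue)"
    using p by (intro nn_integral_mono)
      (auto simp: F_def split: split_indicator intro!: ennreal_leI powr_mono2)
  also note w_Lp
  finally have F_fin: "emeasure lebesgue F < \<infinity>"
    by (auto simp: ennreal_mult_less_top ennreal_eq_0_iff not_le)
  define S where "S = \<Omega> \<inter> {x\<in>space lebesgue. w x = 1}"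
  have S [measurable]: "S \<in> sets lebesgue" unfolding S_def by measurable
  have "AE x in lebesgue. x \<in> \<Omega> \<longrightarrow> w x = 1"
    using w1 by (simp add: AE_restrict_space_iff)
  then have "emeasure lebesgue S = emeasure lebesgue \<Omega>"
    by (intro emeasure_eq_AE) (auto simp: S_def elim!: eventually_mono)
  moreover have "emeasure lebesgue \<Omega> \<noteq> 0"
    using measure_open_pos[OF \<open>open \<Omega>\<close> ne fin] by (auto simp: measure_def)
  ultimately have S0: "emeasure lebesgue S \<noteq> 0" by simp
  \<comment> \<open>Finite total energy makes the inner integral finite almost everywhere, hence at
    some point of the non-null set \<open>S\<close>, where \<open>w\<close> is 1.\<close>
  have "\<exists>x\<in>S. (\<integral>\<^sup>+y. ennreal (\<bar>w x - w y\<bar> powr p * \<nu> (x - y)) \<partial>lebesgue) < \<infinity>"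
  proof (rule ccontr)
    assume "\<not> ?thesis"
    then have *: "(\<integral>\<^sup>+y. ennreal (\<bar>w x - w y\<bar> powr p * \<nu> (x - y)) \<partial>lebesgue) = \<infinity>" if "x \<in> S" for x
      using that by (auto simp: not_less top_unique)
    have "\<infinity> * emeasure lebesgue S = (\<integral>\<^sup>+x. \<infinity> * indicator S x \<partial>lebesgue)"
      by (intro nn_integral_cmult_indicator[symmetric]) measurable
    also have "\<dots> \<le> (\<integral>\<^sup>+x. (\<integral>\<^sup>+y. ennreal (\<bar>w x - w y\<bar> powr p * \<nu> (x - y)) \<partial>lebesgue) \<partial>lebesgue)"
      by (intro nn_integral_mono) (auto simp: * split: split_indicator)
    also note w_E
    finally show False using S0 by simp
  qed
  then obtain x where x: "w x = 1"
    and Gx: "(\<integral>\<^sup>+y. ennreal (\<bar>w x - w y\<bar> powr p * \<nu> (x - y)) \<partial>lebesgue) < \<infinity>"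
    by (auto simp: S_def)
  define F' where "F' = (\<lambda>h. x - h) -` F \<inter> space lebesgue"
  have F' [measurable]: "F' \<in> sets lebesgue" unfolding F'_def by measurable
  have ind: "indicator F' (x - y) = (indicator F y :: ennreal)"
      "indicator (- F') (x - y) = (indicator (- F) y :: ennreal)" for y
    by (simp_all add: F'_def split: split_indicator)
  have "emeasure lebesgue F' = emeasure lebesgue F"
    using nn_integral_lebesgue_reflect[of "indicator F'" x] by (simp add: ind del: emeasure_completion)
  then have F'_fin: "emeasure lebesgue F' < \<infinity>" using F_fin by simp
  have "ennreal ((1 / 2) powr p) * (\<integral>\<^sup>+h. ennreal (\<nu> h) * indicator (- F') h \<partial>lebesgue)
      = ennreal ((1 / 2) powr p) * (\<integral>\<^sup>+y. ennreal (\<nu> (x - y)) * indicator (- F) y \<partial>lebesgue)"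
    by (subst nn_integral_lebesgue_reflect[symmetric, of _ x]) (simp_all add: ind)
  also have "\<dots> = (\<integral>\<^sup>+y. ennreal ((1 / 2) powr p) * (ennreal (\<nu> (x - y)) * indicator (- F) y) \<partial>lebesgue)"
    by (intro nn_integral_cmult[symmetric]) measurable
  also have "\<dots> \<le> (\<integral>\<^sup>+y. ennreal (\<bar>w x - w y\<bar> powr p * \<nu> (x - y)) \<partial>lebesgue)"
  proof (intro nn_integral_mono)
    fix y
    show "ennreal ((1 / 2) powr p) * (ennreal (\<nu> (x - y)) * indicator (- F) y)
      \<le> ennreal (\<bar>w x - w y\<bar> powr p * \<nu> (x - y))"
    proof (cases "y \<in> F")
      case False
      then have y: "\<bar>w y\<bar> \<le> 1 / 2" by (simp add: F_def)
      then have "x - y \<noteq> 0" using x by auto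
      then have "0 \<le> \<nu> (x - y)" by (rule nonneg)
      moreover have "(1 / 2) powr p \<le> \<bar>w x - w y\<bar> powr p"
        using p x y by (intro powr_mono2) auto
      ultimately show ?thesis using False
        by (auto simp flip: ennreal_mult intro!: ennreal_leI mult_right_mono)
    qed simp
  qed
  also note Gx
  finally have out: "(\<integral>\<^sup>+h. ennreal (\<nu> h) * indicator (- F') h \<partial>lebesgue) < \<infinity>"
    by (auto simp: ennreal_mult_less_top ennreal_eq_0_iff not_le)
  from s0 superlevel_measurable[OF \<nu>, of s] have "AE h in lebesgue. \<not> (h \<noteq> 0 \<and> s < \<nu> h)"
    by (intro AE_I'[of "{h. h \<noteq> 0 \<and> s < \<nu> h}"]) (auto simp: null_sets_def)
  moreover have "AE h in lebesgue. h \<noteq> (0::'a)" by (rule AE_I[of _ _ "{0}"]) auto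
  ultimately have ae: "AE h in lebesgue. \<nu> h \<le> s" by eventually_elim auto
  \<comment> \<open>An essential bound \<open>s\<close> would also control the remaining set
    \<open>F'\<close> of finite measure, making the kernel integrable.\<close>
  have "(\<integral>\<^sup>+h. ennreal (\<nu> h) \<partial>lebesgue)
      \<le> (\<integral>\<^sup>+h. ennreal (\<nu> h) * indicator (- F') h + ennreal s * indicator F' h \<partial>lebesgue)"
    using ae by (intro nn_integral_mono_AE) (auto elim!: eventually_mono intro: ennreal_leI split: split_indicator)
  also have "\<dots> = (\<integral>\<^sup>+h. ennreal (\<nu> h) * indicator (- F') h \<partial>lebesgue) + ennreal s * emeasure lebesgue F'"
    by (subst nn_integral_add) (simp_all add: nn_integral_cmult_indicator del: emeasure_completion)
  also have "\<dots> < \<infinity>" using out F'_fin by (simp add: ennreal_mult_less_top)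
  finally show False using inf by simp
qed

section \<open>Orlicz kernels\<close>

text \<open>On a set of finite measure the Orlicz class lies in \<open>L^p\<close>, where the
  Poincare argument operates: scaling down to 1 shows that \<open>t powr p\<close> is at most
  \<open>g t / g 1\<close> for \<open>t > 1\<close>.\<close>

lemma (in nonlocal_sobolev) Lp_space_of_modular:
  assumes \<Omega>: "\<Omega> \<in> sets lebesgue" "emeasure lebesgue \<Omega> < \<infinity>"
    and u [measurable]: "u \<in> borel_measurable (lebesgue_on \<Omega>)" and l: "0 < l"
    and fin: "(\<integral>\<^sup>+x. ennreal (g (\<bar>u x\<bar> / l)) \<partial>lebesgue_on \<Omega>) < \<infinity>"
  shows "u \<in> Lp_space p \<Omega>"
proof -
  have g1: "0 < g 1" by (rule g_pos) simp
  have le: "\<bar>u x\<bar> powr p \<le> l powr p + l powr p / g 1 * g (\<bar>u x\<bar> / l)" for x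
  proof -
    let ?t = "\<bar>u x\<bar> / l"
    have "t powr p \<le> 1 + g t / g 1" if "0 \<le> t" for t
    proof (cases "1 < t")
      case True
      have "g (1 / t * t) \<le> (1 / t) powr p * g t" using True by (intro g_scale) auto
      then have "t powr p \<le> g t / g 1" using True g1 by (simp add: powr_divide field_simps)
      then show ?thesis by simp
    next
      case False
      then have "t powr p \<le> 1" using that p_ge_1 by (intro powr_le1) auto
      moreover have "0 \<le> g t / g 1" using g1 g_nonneg[OF that] by simp
      ultimately show ?thesis by linarith
    qed
    from this[of ?t] have "?t powr p \<le> 1 + g ?t / g 1" using l by simp
    then have "l powr p * ?t powr p \<le> l powr p * (1 + g ?t / g 1)" by (intro mult_left_mono) auto
    moreover have "\<bar>u x\<bar> powr p = l powr p * ?t powr p" using l by (simp add: powr_divide)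
    ultimately show ?thesis by (simp add: distrib_left)
  qed
  have "Lp_integral p \<Omega> u
      \<le> (\<integral>\<^sup>+x. ennreal (l powr p) + ennreal (l powr p / g 1) * ennreal (g (\<bar>u x\<bar> / l)) \<partial>lebesgue_on \<Omega>)"
    unfolding Lp_integral_def
  proof (intro nn_integral_mono)
    fix x
    have "0 \<le> g (\<bar>u x\<bar> / l)" using l by (intro g_nonneg) auto
    then show "ennreal (\<bar>u x\<bar> powr p) \<le> ennreal (l powr p) + ennreal (l powr p / g 1) * ennreal (g (\<bar>u x\<bar> / l))"
      using le[of x] g1 by (simp flip: ennreal_plus ennreal_mult add: ennreal_leI)
  qed
  also have "\<dots> = (\<integral>\<^sup>+x. ennreal (l powr p) \<partial>lebesgue_on \<Omega>)
      + ennreal (l powr p / g 1) * (\<integral>\<^sup>+x. ennreal (g (\<bar>u x\<bar> / l)) \<partial>lebesgue_on \<Omega>)"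
  proof -
    have [measurable]: "(\<lambda>x. g (\<bar>u x\<bar> / l)) \<in> borel_measurable (lebesgue_on \<Omega>)"
      using u l by (rule modular_measurable)
    show ?thesis by (subst nn_integral_add, measurable, subst nn_integral_cmult) auto
  qed
  also have "\<dots> = ennreal (l powr p * measure lebesgue \<Omega>)
      + ennreal (l powr p / g 1) * (\<integral>\<^sup>+x. ennreal (g (\<bar>u x\<bar> / l)) \<partial>lebesgue_on \<Omega>)"
    by (subst nn_integral_const_lebesgue_on[OF \<Omega>]) auto
  also have "\<dots> < \<infinity>" using fin by (simp add: ennreal_mult_less_top)
  finally show ?thesis using u by (simp add: Lp_space_def)
qed

section \<open>From the potential to the abstract Sobolev setting\<close>

locale orlicz_kernel =
  fixes p :: real and \<nu> :: "'a::euclidean_space \<Rightarrow> real"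
  assumes p_ge_1: "1 \<le> p"
    and \<nu>_measurable: "\<nu> \<in> borel_measurable (lebesgue_on (- {0}))"
    and \<nu>_nonneg: "h \<noteq> 0 \<Longrightarrow> 0 \<le> \<nu> h"
    and nu_sharp_finite: "0 < r \<Longrightarrow> nu_sharp \<nu> r < \<infinity>"
    and bij_potential: "bij_betw (potential \<nu> p) {0..} {0..}"
    and young: "young_function (orlicz_phi_p \<nu> p)"
    and submultiplicative: "\<exists>\<theta>>0. \<forall>s t :: real. 0 \<le> s \<and> s \<le> t \<and> 0 < t \<longrightarrow>
      orlicz_phi \<nu> p (ennreal (\<theta> * (s / t))) \<le> orlicz_phi \<nu> p (ennreal s) / orlicz_phi \<nu> p (ennreal t)"
    and almost_decreasing: "almost_decreasing \<nu>"
begin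

text \<open>The real-valued form of \<open>orlicz_phi\<close> on finite arguments: the potential
  vanishes at 0, so its inverse is positive at \<open>1 / t\<close> and no infinite value
  arises.\<close>

definition phi_real :: "real \<Rightarrow> real" where
  "phi_real t = (if t = 0 then 0 else 1 / inv_into {0..} (potential \<nu> p) (1 / t))"

lemma kernel_measurable: "\<nu> \<in> borel_measurable lebesgue"
proof (rule measurable_discrete_difference[where X="{0}"])
  show "(\<lambda>h. indicator (- {0}) h *\<^sub>R \<nu> h) \<in> borel_measurable lebesgue"
    using \<nu>_measurable by (subst (asm) borel_measurable_restrict_space_iff) auto
qed auto

lemma inverse_potential:
  assumes "0 < t"
  shows "0 < inv_into {0..} (potential \<nu> p) (1 / t)"
    and "potential \<nu> p (inv_into {0..} (potential \<nu> p) (1 / t)) = 1 / t"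
proof -
  let ?r = "inv_into {0..} (potential \<nu> p) (1 / t)"
  have "1 / t \<in> potential \<nu> p ` {0..}" using bij_potential assms by (simp add: bij_betw_def)
  then show r: "potential \<nu> p ?r = 1 / t" and "0 < ?r"
    using f_inv_into_f[of "1 / t" "potential \<nu> p" "{0..}"] inv_into_into[of "1 / t" "potential \<nu> p" "{0..}"] assms
    by (auto simp: less_le potential_def split: if_splits)
qed

lemma phi_real_pos: "0 < t \<Longrightarrow> 0 < phi_real t"
  using inverse_potential(1)[of t] by (simp add: phi_real_def)

lemma orlicz_phi_ennreal:
  assumes "0 \<le> t"
  shows "orlicz_phi \<nu> p (ennreal t) = ennreal (phi_real t)"
proof (cases "t = 0")
  case False
  then have t: "0 < t" using assms by simp
  then have "1 / ennreal t = ennreal (1 / t)" using divide_ennreal[of 1 t] by simp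
  then show ?thesis
    using t inverse_potential(1)[OF t] divide_ennreal[of 1 "inv_into {0..} (potential \<nu> p) (1 / t)"]
    by (simp add: orlicz_phi_def phi_real_def)
qed (simp add: orlicz_phi_def phi_real_def)

text \<open>For \<open>r = 1 / phi_real t\<close> the potential equals \<open>1 / t\<close>, which
  says that \<open>r\<close> times \<open>nu_sharp\<close> at \<open>r\<close> is
  \<open>1 / t powr p\<close>. Finiteness of \<open>nu_sharp\<close> lets \<open>enn2real\<close> be
  undone.\<close>

lemma nu_sharp_phi_real:
  assumes t: "0 < t"
  shows "nu_sharp \<nu> (1 / phi_real t) = ennreal (phi_real t / t powr p)"
proof -
  let ?r = "1 / phi_real t"
  have r: "0 < ?r" using phi_real_pos[OF t] by simp
  have "?r = inv_into {0..} (potential \<nu> p) (1 / t)" using t by (simp add: phi_real_def)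
  then have "(?r * enn2real (nu_sharp \<nu> ?r)) powr (1 / p) = 1 / t"
    using inverse_potential(2)[OF t] r by (simp add: potential_def)
  then have "((?r * enn2real (nu_sharp \<nu> ?r)) powr (1 / p)) powr p = (1 / t) powr p" by simp
  then have "?r * enn2real (nu_sharp \<nu> ?r) = 1 / t powr p"
    using p_ge_1 r t by (simp add: powr_powr powr_divide)
  then have "enn2real (nu_sharp \<nu> ?r) = phi_real t / t powr p"
    using phi_real_pos[OF t] t by (simp add: field_simps)
  then show ?thesis using nu_sharp_finite[OF r] by (metis ennreal_enn2real infinity_ennreal_def)
qed

text \<open>Convexity of \<open>orlicz_phi_p\<close> between 0 and \<open>t powr p\<close>, with
  weight \<open>c powr p\<close>.\<close>

lemma phi_real_scale:
  assumes c: "0 < c" "c \<le> 1" and t: "0 < t"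
  shows "phi_real (c * t) \<le> c powr p * phi_real t"
proof -
  have \<phi>p: "orlicz_phi_p \<nu> p (ennreal (\<tau> powr p)) = ennreal (phi_real \<tau>)" if "0 < \<tau>" for \<tau>
    using that p_ge_1 by (simp add: orlicz_phi_p_def ennreal_powr_ennreal powr_powr orlicz_phi_ennreal)
  have cp: "c powr p \<in> {0..1}" using c p_ge_1 by (auto intro: powr_le1)
  then have "orlicz_phi_p \<nu> p (ennreal (c powr p) * ennreal (t powr p) + ennreal (1 - c powr p) * 0)
      \<le> ennreal (c powr p) * orlicz_phi_p \<nu> p (ennreal (t powr p))
        + ennreal (1 - c powr p) * orlicz_phi_p \<nu> p 0"
    using young unfolding young_function_def by blast
  moreover have "ennreal (c powr p) * ennreal (t powr p) = ennreal ((c * t) powr p)"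
    using c t by (simp add: powr_mult ennreal_mult)
  moreover have "orlicz_phi_p \<nu> p 0 = 0" using young by (simp add: young_function_def)
  ultimately have "ennreal (phi_real (c * t)) \<le> ennreal (c powr p) * ennreal (phi_real t)"
    using \<phi>p[of "c * t"] \<phi>p[of t] c t by simp
  then show ?thesis using phi_real_pos[OF t] by (simp flip: ennreal_mult)
qed

text \<open>Submultiplicativity for the pair \<open>t\<close> and \<open>4 * t\<close>: their ratio
  is the constant 1/4, so the left side is the fixed number
  \<open>phi_real (\<theta> / 4)\<close>.\<close>

lemma phi_real_doubling: "\<exists>D>0. \<forall>t>0. phi_real (4 * t) \<le> D * phi_real t"
proof -
  obtain \<theta> where \<theta>: "0 < \<theta>" "\<And>s t :: real. 0 \<le> s \<Longrightarrow> s \<le> t \<Longrightarrow> 0 < t \<Longrightarrow>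
      orlicz_phi \<nu> p (ennreal (\<theta> * (s / t))) \<le> orlicz_phi \<nu> p (ennreal s) / orlicz_phi \<nu> p (ennreal t)"
    using submultiplicative by blast
  have pos: "0 < phi_real (\<theta> / 4)" using \<theta>(1) by (intro phi_real_pos) simp
  have "phi_real (4 * t) \<le> 1 / phi_real (\<theta> / 4) * phi_real t" if t: "0 < t" for t
  proof -
    have t4: "0 < phi_real (4 * t)" using t by (intro phi_real_pos) simp
    have "orlicz_phi \<nu> p (ennreal (\<theta> * (t / (4 * t))))
        \<le> orlicz_phi \<nu> p (ennreal t) / orlicz_phi \<nu> p (ennreal (4 * t))"
      using t by (intro \<theta>(2)) auto
    moreover have "\<theta> * (t / (4 * t)) = \<theta> / 4" using t by simp
    ultimately have "ennreal (phi_real (\<theta> / 4)) \<le> ennreal (phi_real t) / ennreal (phi_real (4 * t))"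
      using \<theta>(1) t by (simp add: orlicz_phi_ennreal)
    also have "\<dots> = ennreal (phi_real t / phi_real (4 * t))"
      using t4 phi_real_pos[OF t] by (intro divide_ennreal) auto
    finally have "phi_real (\<theta> / 4) \<le> phi_real t / phi_real (4 * t)"
      using t4 phi_real_pos[OF t] by simp
    then show ?thesis using t4 pos by (simp add: field_simps)
  qed
  then show ?thesis using pos by (intro exI[of _ "1 / phi_real (\<theta> / 4)"]) auto
qed

text \<open>Without positive values far out, all superlevel sets would lie in one ball. At
  \<open>r\<close> equal to its volume the rearrangement and \<open>nu_sharp\<close> would vanish,
  so the potential would be 0 at \<open>r\<close> as well as at 0, against injectivity.\<close>

lemma kernel_positive_far: "\<exists>x. x \<noteq> 0 \<and> R \<le> norm x \<and> 0 < \<nu> x"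
proof (rule ccontr)
  assume contr: "\<not> ?thesis"
  define B where "B = cball (0::'a) (max R 1)"
  define r where "r = measure lebesgue B"
  have "measure lebesgue (ball (0::'a) 1) \<le> r"
    unfolding r_def B_def by (intro measure_mono_fmeasurable) auto
  moreover have "0 < measure lebesgue (ball (0::'a) 1)"
    using unit_ball_measure_pos[where 'a='a] by (simp add: unit_ball_measure_def)
  ultimately have r: "0 < r" by (rule order_less_le_trans[rotated])
  have B_r: "emeasure lebesgue B = ennreal r"
    unfolding r_def B_def by (intro emeasure_eq_measure2) simp
  have sub: "{h. h \<noteq> 0 \<and> s < \<nu> h} \<subseteq> B" if "0 < s" for s
    using contr that by (force simp: B_def)
  have "sym_rearrangement \<nu> (eta TYPE('a) r) \<le> ennreal s" if "0 < s" for s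
    unfolding sym_rearrangement_def eta_power[OF r]
    using emeasure_mono[OF sub[OF that], of lebesgue] that
    by (intro Inf_lower) (auto simp: B_r[symmetric] B_def simp del: emeasure_completion)
  then have "sym_rearrangement \<nu> (eta TYPE('a) r) \<le> 0"
    using ennreal_le_epsilon[of 0] by simp
  then have "nu_sharp \<nu> r = 0" by (simp add: nu_sharp_def)
  then have "potential \<nu> p r = potential \<nu> p 0" using r by (simp add: potential_def)
  then have "r = 0" using bij_potential r by (simp add: bij_betw_def inj_on_def)
  with r show False by simp
qed

text \<open>Almost monotonicity compares the whole ball with one point at distance at least
  \<open>R\<close> where the kernel is positive.\<close>

lemma kernel_bounded_below: "\<exists>c>0. \<forall>h. h \<noteq> 0 \<and> norm h \<le> R \<longrightarrow> c \<le> \<nu> h"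
proof -
  obtain \<kappa> where \<kappa>: "0 < \<kappa>" "\<And>x y. x \<noteq> 0 \<Longrightarrow> y \<noteq> 0 \<Longrightarrow> norm y \<le> norm x \<Longrightarrow> \<kappa> * \<nu> x \<le> \<nu> y"
    using almost_decreasing unfolding almost_decreasing_def by blast
  obtain x where x: "x \<noteq> 0" "R \<le> norm x" "0 < \<nu> x" using kernel_positive_far by blast
  show ?thesis using \<kappa> x by (intro exI[of _ "\<kappa> * \<nu> x"]) auto
qed

lemma nonlocal_sobolev_phi_real:
  obtains D where "nonlocal_sobolev p \<nu> phi_real D"
proof -
  obtain D where D: "0 < D" "\<And>t. 0 < t \<Longrightarrow> phi_real (4 * t) \<le> D * phi_real t"
    using phi_real_doubling by blast
  have "nonlocal_sobolev p \<nu> phi_real D"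
  proof
    fix t :: real and F :: "'a set" assume t: "0 < t" and F: "F \<in> sets lebesgue" "emeasure lebesgue F \<le> ennreal (1 / phi_real t)"
    show "ennreal (phi_real t / t powr p) \<le> (\<integral>\<^sup>+h\<in>- F. ennreal (\<nu> h) \<partial>lebesgue)"
      unfolding nu_sharp_phi_real[OF t, symmetric]
      using phi_real_pos[OF t] F by (intro nu_sharp_le_nn_integral_Compl kernel_measurable) auto
  qed (use p_ge_1 \<nu>_nonneg kernel_measurable phi_real_pos phi_real_scale D kernel_bounded_below in
        \<open>auto simp: phi_real_def\<close>)
  then show thesis by (rule that)
qed

text \<open>The ratio of \<open>phi_real t\<close> to \<open>t powr p\<close> is
  \<open>nu_sharp\<close> at \<open>1 / phi_real t\<close>. This argument drops below any given
  \<open>r0\<close>, where \<open>nu_sharp\<close> is at least \<open>M\<close>.\<close>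

lemma phi_real_superlinear:
  assumes ext: "nonlocal_extension_domain p \<nu> \<Omega>" and fin: "emeasure lebesgue \<Omega> < \<infinity>" and ne: "\<Omega> \<noteq> {}"
    and inf: "(\<integral>\<^sup>+h. ennreal (\<nu> h) \<partial>lebesgue) = \<infinity>"
  shows "\<exists>T>0. \<forall>t\<ge>T. M * t powr p \<le> phi_real t"
proof -
  obtain r0 where r0: "0 < r0" "ennreal M \<le> nu_sharp \<nu> r0"
    using nu_sharp_unbounded[OF kernel_measurable inf
        extension_domain_kernel_unbounded[OF p_ge_1 kernel_measurable \<nu>_nonneg ext fin ne inf]]
    by blast
  obtain D where "nonlocal_sobolev p \<nu> phi_real D" using nonlocal_sobolev_phi_real .
  then interpret nonlocal_sobolev p \<nu> phi_real D .
  have pos1: "0 < phi_real 1" by (rule phi_real_pos) simp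
  \<comment> \<open>Convexity gives \<open>t * phi_real 1 \<le> phi_real t\<close> for
    \<open>t\<close> at least 1, so from \<open>T\<close> on \<open>1 / phi_real t\<close> is at
    most \<open>r0\<close>.\<close>
  define T where "T = max 1 (1 / (r0 * phi_real 1))"
  have "M * t powr p \<le> phi_real t" if t: "T \<le> t" for t
  proof -
    have t1: "1 \<le> t" and t2: "1 / (r0 * phi_real 1) \<le> t" using t by (auto simp: T_def)
    have "phi_real (1 / t * t) \<le> (1 / t) powr p * phi_real t" using t1 by (intro phi_real_scale) auto
    also have "\<dots> \<le> (1 / t) powr 1 * phi_real t"
      using t1 p_ge_1 phi_real_pos[of t] by (intro mult_right_mono powr_mono') auto
    finally have "t * phi_real 1 \<le> phi_real t" using t1 by (simp add: field_simps)
    moreover have "1 / r0 \<le> t * phi_real 1" using t2 r0(1) pos1 by (simp add: field_simps)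
    ultimately have "1 / r0 \<le> phi_real t" by linarith
    then have "1 / phi_real t \<le> r0" using r0(1) t1 phi_real_pos[of t] by (simp add: field_simps)
    then have "nu_sharp \<nu> r0 \<le> nu_sharp \<nu> (1 / phi_real t)"
      using phi_real_pos[of t] t1 by (intro nu_sharp_antimono) auto
    with r0(2) have "ennreal M \<le> ennreal (phi_real t / t powr p)"
      using t1 by (simp add: nu_sharp_phi_real)
    then have "M \<le> phi_real t / t powr p"
      using t1 phi_real_pos[of t] by (subst (asm) ennreal_le_iff) auto
    then show ?thesis using t1 by (simp add: field_simps)
  qed
  moreover have "0 < T" by (simp add: T_def)
  ultimately show ?thesis by blast
qed

theorem orlicz_sobolev_poincare:
  assumes ext: "nonlocal_extension_domain p \<nu> \<Omega>" and fin: "emeasure lebesgue \<Omega> < \<infinity>"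
    and alt: "bounded \<Omega> \<or> (\<integral>\<^sup>+h. ennreal (\<nu> h) \<partial>lebesgue) = \<infinity>"
  shows "\<exists>C>0. \<forall>u\<in>orlicz_space (orlicz_phi \<nu> p) \<Omega>.
    luxemburg_norm (orlicz_phi \<nu> p) \<Omega> (\<lambda>x. u x - mean \<Omega> u)
      \<le> ennreal C * ennreal_powr (nonlocal_energy p \<nu> \<Omega> u) (1 / p)"
proof -
  obtain D where "nonlocal_sobolev p \<nu> phi_real D" using nonlocal_sobolev_phi_real .
  then interpret S: nonlocal_sobolev p \<nu> phi_real D .
  have "open \<Omega>" using ext by (simp add: nonlocal_extension_domain_def)
  then have \<Omega>: "\<Omega> \<in> sets lebesgue" by simp
  have "bounded \<Omega> \<or> (\<forall>M. \<exists>T>0. \<forall>t\<ge>T. M * t powr p \<le> phi_real t)"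
    using alt phi_real_superlinear[OF ext fin] by (cases "\<Omega> = {}") auto
  then obtain K where K: "0 < K" "\<And>u l. u \<in> Lp_space p \<Omega> \<Longrightarrow> 0 < l \<Longrightarrow>
      nonlocal_energy p \<nu> \<Omega> u \<le> ennreal (K * l powr p) \<Longrightarrow>
      (\<integral>\<^sup>+x. ennreal (phi_real (\<bar>u x - mean \<Omega> u\<bar> / l)) \<partial>lebesgue_on \<Omega>) \<le> 1"
    using S.sobolev_poincare_modular[OF ext fin] by blast
  have modular_eq: "(\<integral>\<^sup>+x. orlicz_phi \<nu> p (ennreal (\<bar>v x\<bar> / l)) \<partial>lebesgue_on \<Omega>)
      = (\<integral>\<^sup>+x. ennreal (phi_real (\<bar>v x\<bar> / l)) \<partial>lebesgue_on \<Omega>)" if "0 < l" for v l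
    using that by (intro nn_integral_cong orlicz_phi_ennreal) simp
  \<comment> \<open>The factor 1 is the \<open>a\<close> of the scale lemma: a modular at most 1 at
    scale \<open>l\<close> bounds the Luxemburg norm by \<open>l\<close> itself.\<close>
  have "luxemburg_norm (orlicz_phi \<nu> p) \<Omega> (\<lambda>x. u x - mean \<Omega> u)
      \<le> ennreal (1 * (1 / K) powr (1 / p)) * ennreal_powr (nonlocal_energy p \<nu> \<Omega> u) (1 / p)"
    if u: "u \<in> orlicz_space (orlicz_phi \<nu> p) \<Omega>" for u
  proof (rule le_ennreal_powr_of_scales)
    obtain l0 where "0 < l0" "(\<integral>\<^sup>+x. orlicz_phi \<nu> p (ennreal (\<bar>u x\<bar> / l0)) \<partial>lebesgue_on \<Omega>) < \<infinity>"
      and u_meas: "u \<in> borel_measurable (lebesgue_on \<Omega>)"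
      using u by (auto simp: orlicz_space_def)
    then have u_Lp: "u \<in> Lp_space p \<Omega>"
      using S.Lp_space_of_modular[OF \<Omega> fin u_meas] by (simp add: modular_eq)
    fix l :: real assume l: "0 < l" and "nonlocal_energy p \<nu> \<Omega> u \<le> ennreal (K * l powr p)"
    then have "(\<integral>\<^sup>+x. orlicz_phi \<nu> p (ennreal (\<bar>u x - mean \<Omega> u\<bar> / l)) \<partial>lebesgue_on \<Omega>) \<le> 1"
      using K(2)[OF u_Lp l] modular_eq[OF l, of "\<lambda>x. u x - mean \<Omega> u"] by simp
    then show "luxemburg_norm (orlicz_phi \<nu> p) \<Omega> (\<lambda>x. u x - mean \<Omega> u) \<le> ennreal (1 * l)"
      unfolding luxemburg_norm_def using l by (intro Inf_lower) auto
  qed (use K(1) p_ge_1 in auto)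
  moreover have "0 < 1 * (1 / K) powr (1 / p)" using K(1) by simp
  ultimately show ?thesis by blast
qed

end

section \<open>The fractional kernel\<close>

text \<open>A ball of volume \<open>2 * r\<close> keeps volume at least \<open>r\<close> after
  \<open>F\<close> is removed, and inside it the kernel is at least its value at the boundary
  radius. This costs a constant but gives the right power of \<open>r\<close>.\<close>

lemma fractional_kernel_tail:
  fixes F :: "'a::euclidean_space set"
  assumes q: "0 < q" "q = s * p / real DIM('a)" and r: "0 < r"
    and F: "F \<in> sets lebesgue" "emeasure lebesgue F \<le> ennreal r"
  shows "ennreal ((2 / unit_ball_measure TYPE('a)) powr (- 1 - q) * r powr (- q))
    \<le> (\<integral>\<^sup>+h\<in>- F. ennreal (fractional_kernel s p h) \<partial>lebesgue)"
proof -
  let ?V = "unit_ball_measure TYPE('a)"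
  define R where "R = eta TYPE('a) (2 * r)"
  have R: "0 < R" using r by (simp add: R_def eta_pos)
  \<comment> \<open>The origin is removed because \<open>0 powr e\<close> is 0, so the lower bound
    fails there.\<close>
  define B where "B = ball (0::'a) R - {0} - F"
  have B [measurable]: "B \<in> sets lebesgue" unfolding B_def using F(1) by auto
  have "emeasure lebesgue (ball (0::'a) R) = ennreal (2 * r)"
  proof -
    have "measure lebesgue (ball (0::'a) R) = ?V * R ^ DIM('a)"
      using R by (simp add: content_ball unit_ball_measure_eq)
    also have "\<dots> = 2 * r" unfolding R_def using r by (intro eta_power) simp
    finally show ?thesis
      using emeasure_eq_measure2[of "ball (0::'a) R" lebesgue] by simp
  qed
  moreover have "emeasure lebesgue (ball (0::'a) R) \<le> emeasure lebesgue (B \<union> ({0} \<union> F))"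
  proof (rule emeasure_mono)
    show "B \<union> ({0} \<union> F) \<in> sets lebesgue" by (intro sets.Un B F(1)) simp
  qed (auto simp: B_def)
  moreover have "emeasure lebesgue (B \<union> ({0} \<union> F)) \<le> emeasure lebesgue B + (emeasure lebesgue {0::'a} + emeasure lebesgue F)"
  proof -
    have "{0} \<union> F \<in> sets lebesgue" by (intro sets.Un F(1)) simp
    then have "emeasure lebesgue (B \<union> ({0} \<union> F)) \<le> emeasure lebesgue B + emeasure lebesgue ({0} \<union> F)"
      by (rule emeasure_subadditive[OF B])
    also have "\<dots> \<le> emeasure lebesgue B + (emeasure lebesgue {0::'a} + emeasure lebesgue F)"
      by (intro add_left_mono emeasure_subadditive F(1)) simp
    finally show ?thesis .
  qed
  ultimately have "ennreal (2 * r) \<le> emeasure lebesgue B + (emeasure lebesgue {0::'a} + emeasure lebesgue F)"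
    by (metis order_trans)
  also have "emeasure lebesgue {0::'a} = 0" by simp
  also have "emeasure lebesgue B + (0 + emeasure lebesgue F) \<le> ennreal r + emeasure lebesgue B"
    unfolding add_0 by (subst add.commute) (intro add_right_mono F(2))
  also have "ennreal (2 * r) = ennreal r + ennreal r" using r by (simp flip: ennreal_plus)
  finally have B_r: "ennreal r \<le> emeasure lebesgue B" by (simp add: ennreal_add_left_cancel_le)
  define e where "e = - real DIM('a) - s * p"
  have e: "e = real DIM('a) * (- 1 - q)" using q(2) by (simp add: e_def field_simps)
  have e_neg: "e \<le> 0" using q(1) by (simp add: e mult_nonneg_nonpos)
  have "R powr e = (2 / ?V * r) powr (- 1 - q)"
    using r unit_ball_measure_pos[where 'a='a] by (simp add: R_def eta_def powr_powr e)
  also have "\<dots> = (2 / ?V) powr (- 1 - q) * r powr (- 1 - q)" by (rule powr_mult)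
  finally have "R powr e * r = (2 / ?V) powr (- 1 - q) * (r powr (- 1 - q) * r)" by simp
  moreover have "r powr (- 1 - q) * r = r powr (- q)"
    using r powr_add[of r "- 1 - q" 1] by simp
  ultimately have eq: "(2 / ?V) powr (- 1 - q) * r powr (- q) = R powr e * r" by simp
  have "ennreal (R powr e * r) = ennreal (R powr e) * ennreal r" using r by (simp add: ennreal_mult)
  also have "\<dots> \<le> ennreal (R powr e) * emeasure lebesgue B" by (intro mult_left_mono B_r) simp
  also have "\<dots> = (\<integral>\<^sup>+h. ennreal (R powr e) * indicator B h \<partial>lebesgue)"
    by (intro nn_integral_cmult_indicator[symmetric] B)
  also have "\<dots> \<le> (\<integral>\<^sup>+h\<in>- F. ennreal (fractional_kernel s p h) \<partial>lebesgue)"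
    using R e_neg by (intro nn_integral_mono)
      (auto simp: B_def fractional_kernel_def e_def[symmetric] split: split_indicator
        intro!: ennreal_leI powr_mono2')
  finally show ?thesis by (simp only: eq)
qed

lemma nonlocal_sobolev_fractional:
  fixes s p pstar :: real
  assumes p: "1 \<le> p" and s: "0 < s" and pstar: "0 < pstar" "1 / pstar = 1 / p - s / real DIM('a::euclidean_space)"
  obtains c D where "0 < c"
    "nonlocal_sobolev p (fractional_kernel s p :: 'a \<Rightarrow> real) (\<lambda>t. c * t powr pstar) D"
proof -
  let ?V = "unit_ball_measure TYPE('a)" and ?\<nu> = "fractional_kernel s p :: 'a \<Rightarrow> real"
  define q where "q = s * p / real DIM('a)"
  have q: "0 < q" using s p by (simp add: q_def)
  have "p * (1 / pstar) = p * (1 / p - s / real DIM('a))" using pstar(2) by simp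
  then have "p / pstar = 1 - q" using p by (simp add: q_def right_diff_distrib mult.commute)
  then have q_eq: "pstar * q = pstar - p" using pstar(1) by (simp add: field_simps)
  then have less: "p < pstar" using q pstar(1) by (smt (verit) mult_pos_pos)
  define b where "b = (2 / ?V) powr (- 1 - q)"
  have b: "0 < b" using unit_ball_measure_pos[where 'a='a] by (simp add: b_def)
  \<comment> \<open>Inserting \<open>r = 1 / (c * t powr pstar)\<close> into the tail bound gives
    \<open>b * c powr q * t powr (pstar - p)\<close>, so \<open>c\<close> has to solve
    \<open>b * c powr q = c\<close>; here \<open>1 - q = p / pstar\<close>.\<close>
  define c where "c = b powr (pstar / p)"
  have c: "0 < c" using b by (simp add: c_def)
  have c_q: "b * c powr q = c"
  proof -
    have "1 + pstar / p * q = pstar / p" using q_eq p by (simp add: field_simps)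
    moreover have "b powr 1 * (b powr (pstar / p)) powr q = b powr (1 + pstar / p * q)"
      using b by (simp only: powr_powr powr_add)
    ultimately show ?thesis using b by (simp add: c_def)
  qed
  have "nonlocal_sobolev p ?\<nu> (\<lambda>t. c * t powr pstar) (4 powr pstar)"
  proof
    show "?\<nu> \<in> borel_measurable lebesgue"
      unfolding fractional_kernel_def by (intro measurable_completion) measurable
    have "0 \<le> s * p" using s p by simp
    then have "- real DIM('a) - s * p \<le> 0" by simp
    then show "\<exists>c>0. \<forall>h. h \<noteq> 0 \<and> norm h \<le> R \<longrightarrow> c \<le> ?\<nu> h" if "0 < R" for R
      using that
      by (intro exI[of _ "R powr (- real DIM('a) - s * p)"] conjI allI impI)
         (auto simp only: fractional_kernel_def powr_gt_zero zero_less_norm_iff intro!: powr_mono2')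
    show "c * (a * t) powr pstar \<le> a powr p * (c * t powr pstar)" if "0 < a" "a \<le> 1" "0 < t" for a t
    proof -
      have "a powr pstar \<le> a powr p" using that less by (intro powr_mono') auto
      then have "a powr pstar * (c * t powr pstar) \<le> a powr p * (c * t powr pstar)"
        using c by (intro mult_right_mono) auto
      then show ?thesis using that by (simp add: powr_mult mult_ac)
    qed
    fix t :: real and F :: "'a set"
    assume t: "0 < t" and F: "F \<in> sets lebesgue" "emeasure lebesgue F \<le> ennreal (1 / (c * t powr pstar))"
    have "(1 / (c * t powr pstar)) powr (- q) = (c * t powr pstar) powr q"
      using c t by (simp add: powr_divide powr_minus_divide)
    also have "\<dots> = c powr q * t powr (pstar - p)"
      using c t by (simp add: powr_mult powr_powr q_eq)
    finally have "b * (1 / (c * t powr pstar)) powr (- q) = c * t powr pstar / t powr p"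
      using c_q by (simp add: powr_diff flip: mult.assoc)
    then show "ennreal (c * t powr pstar / t powr p) \<le> (\<integral>\<^sup>+h\<in>- F. ennreal (?\<nu> h) \<partial>lebesgue)"
      using fractional_kernel_tail[OF q q_def _ F] c t by (simp add: b_def)
  qed (use p c in \<open>auto simp: fractional_kernel_def powr_mult\<close>)
  with c show thesis by (rule that)
qed

theorem fractional_sobolev_poincare:
  fixes \<Omega> :: "'a::euclidean_space set" and s p pstar :: real
  assumes p: "1 \<le> p" and fin: "emeasure lebesgue \<Omega> < \<infinity>"
    and s: "0 < s" and pstar: "0 < pstar" "1 / pstar = 1 / p - s / real DIM('a)"
    and ext: "nonlocal_extension_domain p (fractional_kernel s p :: 'a \<Rightarrow> real) \<Omega>"
  shows "\<exists>C>0. \<forall>u\<in>Lp_space pstar \<Omega>. Lp_norm pstar \<Omega> (\<lambda>x. u x - mean \<Omega> u)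
    \<le> ennreal C * ennreal_powr (nonlocal_energy p (fractional_kernel s p) \<Omega> u) (1 / p)"
proof -
  let ?\<nu> = "fractional_kernel s p :: 'a \<Rightarrow> real"
  obtain c D where c: "0 < c" and "nonlocal_sobolev p ?\<nu> (\<lambda>t. c * t powr pstar) D"
    using nonlocal_sobolev_fractional[OF p s pstar] .
  then interpret S: nonlocal_sobolev p ?\<nu> "\<lambda>t. c * t powr pstar" D by simp
  have "open \<Omega>" using ext by (simp add: nonlocal_extension_domain_def)
  then have \<Omega>: "\<Omega> \<in> sets lebesgue" by simp
  have "1 / pstar < 1 / p" using s pstar(2) by simp
  then have less: "p < pstar" using p pstar(1) by (simp add: field_simps)
  have "\<exists>T>0. \<forall>t\<ge>T. M * t powr p \<le> c * t powr pstar" for M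
  proof -
    \<comment> \<open>Solves \<open>\<bar>M\<bar> \<le> c * t powr (pstar - p)\<close> for
      \<open>t\<close>; the maximum with 1 keeps \<open>T\<close> positive when \<open>M\<close> is
      0.\<close>
    define T where "T = max 1 ((\<bar>M\<bar> / c) powr (1 / (pstar - p)))"
    have "M * t powr p \<le> c * t powr pstar" if t: "T \<le> t" for t
    proof -
      have "((\<bar>M\<bar> / c) powr (1 / (pstar - p))) powr (pstar - p) \<le> t powr (pstar - p)"
        using t less by (intro powr_mono2) (auto simp: T_def)
      then have "\<bar>M\<bar> / c \<le> t powr (pstar - p)" using less c by (simp add: powr_powr)
      then have "M \<le> c * t powr (pstar - p)" using c by (simp add: field_simps)
      then have "M * t powr p \<le> c * t powr (pstar - p) * t powr p" by (intro mult_right_mono) auto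
      also have "\<dots> = c * t powr pstar" by (simp add: mult.assoc flip: powr_add)
      finally show ?thesis .
    qed
    moreover have "0 < T" by (simp add: T_def)
    ultimately show ?thesis by blast
  qed
  then obtain K where K: "0 < K" "\<And>u l. u \<in> Lp_space p \<Omega> \<Longrightarrow> 0 < l \<Longrightarrow>
      nonlocal_energy p ?\<nu> \<Omega> u \<le> ennreal (K * l powr p) \<Longrightarrow>
      (\<integral>\<^sup>+x. ennreal (c * (\<bar>u x - mean \<Omega> u\<bar> / l) powr pstar) \<partial>lebesgue_on \<Omega>) \<le> 1"
    using S.sobolev_poincare_modular[OF ext fin] by blast
  \<comment> \<open>A modular at most 1 bounds the integral of the power \<open>pstar\<close> by
    \<open>l powr pstar / c\<close>, whose root is \<open>a * l\<close>.\<close>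
  define a where "a = (1 / c) powr (1 / pstar)"
  have a: "0 < a" using c by (simp add: a_def)
  have "Lp_norm pstar \<Omega> (\<lambda>x. u x - mean \<Omega> u)
      \<le> ennreal (a * (1 / K) powr (1 / p)) * ennreal_powr (nonlocal_energy p ?\<nu> \<Omega> u) (1 / p)"
    if u: "u \<in> Lp_space pstar \<Omega>" for u
  proof (rule le_ennreal_powr_of_scales)
    have u_meas [measurable]: "u \<in> borel_measurable (lebesgue_on \<Omega>)"
      and u_fin: "(\<integral>\<^sup>+x. ennreal (\<bar>u x\<bar> powr pstar) \<partial>lebesgue_on \<Omega>) < \<infinity>"
      using u by (auto simp: Lp_space_def Lp_integral_def)
    have "(\<integral>\<^sup>+x. ennreal (c * (\<bar>u x\<bar> / 1) powr pstar) \<partial>lebesgue_on \<Omega>)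
        = ennreal c * (\<integral>\<^sup>+x. ennreal (\<bar>u x\<bar> powr pstar) \<partial>lebesgue_on \<Omega>)"
      using c by (simp add: ennreal_mult nn_integral_cmult)
    also have "\<dots> < \<infinity>" using u_fin by (simp add: ennreal_mult_less_top)
    finally have u_Lp: "u \<in> Lp_space p \<Omega>"
      by (rule S.Lp_space_of_modular[OF \<Omega> fin u_meas zero_less_one])
    fix l :: real assume l: "0 < l" and E: "nonlocal_energy p ?\<nu> \<Omega> u \<le> ennreal (K * l powr p)"
    define b where "b = l powr pstar / c"
    have b: "0 < b" using c l by (simp add: b_def)
    have "Lp_integral pstar \<Omega> (\<lambda>x. u x - mean \<Omega> u)
        = (\<integral>\<^sup>+x. ennreal b * ennreal (c * (\<bar>u x - mean \<Omega> u\<bar> / l) powr pstar) \<partial>lebesgue_on \<Omega>)"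
      unfolding Lp_integral_def using c l b
      by (intro nn_integral_cong) (simp add: b_def powr_divide flip: ennreal_mult)
    also have "\<dots> = ennreal b * (\<integral>\<^sup>+x. ennreal (c * (\<bar>u x - mean \<Omega> u\<bar> / l) powr pstar) \<partial>lebesgue_on \<Omega>)"
      by (intro nn_integral_cmult) measurable
    also have "\<dots> \<le> ennreal b * 1" by (intro mult_left_mono K(2) u_Lp l E) simp
    finally have "Lp_norm pstar \<Omega> (\<lambda>x. u x - mean \<Omega> u) \<le> ennreal_powr (ennreal b) (1 / pstar)"
      unfolding Lp_norm_def using pstar(1) by (intro ennreal_powr_mono) auto
    also have "\<dots> = ennreal (b powr (1 / pstar))" using b by (intro ennreal_powr_ennreal) simp
    also have "b powr (1 / pstar) = a * l"
    proof -
      have "b powr (1 / pstar) = (1 / c) powr (1 / pstar) * (l powr pstar) powr (1 / pstar)"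
        using c l powr_mult[of "1 / c" "l powr pstar" "1 / pstar"] by (simp add: b_def)
      then show ?thesis using l pstar(1) by (simp add: a_def powr_powr)
    qed
    finally show "Lp_norm pstar \<Omega> (\<lambda>x. u x - mean \<Omega> u) \<le> ennreal (a * l)" .
  qed (use K(1) p a in auto)
  moreover have "0 < a * (1 / K) powr (1 / p)" using a K(1) by (intro mult_pos_pos) auto
  ultimately show ?thesis by blast
qed

theorem corollary4p4:
  fixes p :: real and \<Omega> :: "'a::euclidean_space set"
  assumes "1 \<le> p"
    and "emeasure lebesgue \<Omega> < \<infinity>"
  shows
    "(\<forall>\<nu> :: 'a \<Rightarrow> real.
        \<nu> \<in> borel_measurable (lebesgue_on (- {0})) \<and>
        (\<forall>h. h \<noteq> 0 \<longrightarrow> 0 \<le> \<nu> h) \<and>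
        (\<forall>r>0. nu_sharp \<nu> r < \<infinity>) \<and>
        bij_betw (potential \<nu> p) {0..} {0..} \<and>
        young_function (orlicz_phi_p \<nu> p) \<and>
        (\<exists>\<theta>>0. \<forall>s t :: real. 0 \<le> s \<and> s \<le> t \<and> 0 < t \<longrightarrow>
           orlicz_phi \<nu> p (ennreal (\<theta> * (s / t)))
             \<le> orlicz_phi \<nu> p (ennreal s) / orlicz_phi \<nu> p (ennreal t)) \<and>
        almost_decreasing \<nu> \<and>
        nonlocal_extension_domain p \<nu> \<Omega> \<and>
        (bounded \<Omega> \<or> (\<integral>\<^sup>+h. ennreal (\<nu> h) \<partial>lebesgue) = \<infinity>)
        \<longrightarrow>
        (\<exists>C>0. \<forall>u\<in>orlicz_space (orlicz_phi \<nu> p) \<Omega>.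
           luxemburg_norm (orlicz_phi \<nu> p) \<Omega> (\<lambda>x. u x - mean \<Omega> u)
             \<le> ennreal C * ennreal_powr (nonlocal_energy p \<nu> \<Omega> u) (1 / p)))
     \<and>
     (\<forall>s pstar :: real.
        0 < s \<and> s < 1 \<and> 0 < pstar \<and> 1 / pstar = 1 / p - s / real DIM('a) \<and>
        nonlocal_extension_domain p (fractional_kernel s p :: 'a \<Rightarrow> real) \<Omega>
        \<longrightarrow>
        (\<exists>C>0. \<forall>u\<in>Lp_space pstar \<Omega>.
           Lp_norm pstar \<Omega> (\<lambda>x. u x - mean \<Omega> u)
             \<le> ennreal C * ennreal_powr (nonlocal_energy p (fractional_kernel s p) \<Omega> u) (1 / p)))"
proof (intro conjI allI impI; elim conjE)
  fix \<nu> :: "'a \<Rightarrow> real"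
  assume "\<nu> \<in> borel_measurable (lebesgue_on (- {0}))" "\<forall>h. h \<noteq> 0 \<longrightarrow> 0 \<le> \<nu> h" "\<forall>r>0. nu_sharp \<nu> r < \<infinity>"
    "bij_betw (potential \<nu> p) {0..} {0..}" "young_function (orlicz_phi_p \<nu> p)"
    "\<exists>\<theta>>0. \<forall>s t :: real. 0 \<le> s \<and> s \<le> t \<and> 0 < t \<longrightarrow>
      orlicz_phi \<nu> p (ennreal (\<theta> * (s / t))) \<le> orlicz_phi \<nu> p (ennreal s) / orlicz_phi \<nu> p (ennreal t)"
    "almost_decreasing \<nu>"
  then interpret orlicz_kernel p \<nu>
    using \<open>1 \<le> p\<close> by unfold_locales auto
  assume "nonlocal_extension_domain p \<nu> \<Omega>" "bounded \<Omega> \<or> (\<integral>\<^sup>+h. ennreal (\<nu> h) \<partial>lebesgue) = \<infinity>"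
  then show "\<exists>C>0. \<forall>u\<in>orlicz_space (orlicz_phi \<nu> p) \<Omega>.
    luxemburg_norm (orlicz_phi \<nu> p) \<Omega> (\<lambda>x. u x - mean \<Omega> u)
      \<le> ennreal C * ennreal_powr (nonlocal_energy p \<nu> \<Omega> u) (1 / p)"
    using \<open>emeasure lebesgue \<Omega> < \<infinity>\<close> by (intro orlicz_sobolev_poincare)
qed (use assms in \<open>rule fractional_sobolev_poincare\<close>)

end
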